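(* Let $x_0\sim\mu$ and let $(x_\sigma,x_{\sigma+1},\dots,x_{\tau_B})$ be the reactive trajectory of the first passage path $(x_0,\dots,x_{\tau_B})$ of the Markov chain with transition probabilities $p$. Let $(y_k)_{k\ge0}$ be the Markov chain on $V^+\cup B$ with initial distribution $\mu_r$ on $A$, where $\mu_r(x)=\mathbb P(x_\sigma=x)$ for $x\in A$, and transition probabilities, for $x,y\in V^+\cup B$, $$\widetilde p(x\,|\,y)=\begin{cases}\dfrac{p(x\,|\,y)\,q(x)}{q(y)}, & y\in V^+\cap A^c,\\[2mm] \dfrac{p(x\,|\,y)\,q(x)}{\sum_{z\in V}p(z\,|\,y)\,q(z)}, & y\in V^+\cap A,\\[2mm] \delta_y(x), & y\in B.\end{cases}$$ Then the ensemble of reactive trajectories is generated by the trajectories of $(y_k)$; that is, the random finite sequence $(x_\sigma,\dots,x_{\tau_B})$ has the same law as $(y_0,\dots,y_\zeta)$, where $\zeta=\min\{k\ge0:y_k\in B\}$.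
   Context: $V=\{1,\dots,n\}$ with $n>1$; $p(y\,|\,x)$, $x,y\in V$, is the probability that a discrete-time Markov chain $(x_k)_{k\ge0}$ on $V$ jumps from $x$ to $y$ (so $\sum_{y}p(y\,|\,x)=1$). $A,B\subset V$ are disjoint and nonempty, complements are taken in $V$, and $\mu$ is a probability distribution on $A$. For $x\in V$, a set $A$ (resp. $B$) is reachable from $x$ if there is a finite path $x_0=x,x_1,\dots,x_k$, $k\ge0$, with $x_k\in A$ (resp. $x_k\in B$), $x_l\in(A\cup B)^c$ for $1\le l\le k-1$, and $p(x_{l+1}\,|\,x_l)>0$ for $0\le l\le k-1$. Standing assumption: $(A\cup B)^c\ne\emptyset$; from each $x\in(A\cup B)^c$ either $A$ or $B$ is reachable; and $B$ is reachable from each $x\in A$. $\tau_A=\min\{k\ge0:x_k\in A\}$, $\tau_B=\min\{k\ge 0:x_k\in B\}$ ($+\infty$ if never reached), with subscript $x$ when $x_0=x$. Committor: $q(x)=\mathbb P(\tau_{B,x}<\tau_{A,x})$, $x\in V$. A first passage path is $(x_0,\dots,x_{\tau_B})$ with $x_0\in B^c$. For $x_0\in A$, the last hitting time of $A$ is $\sigma=\max\{l: x_l\in A,\ 0\le l<\tau_B\}$; the reactive trajectory is $(x_\sigma,\dots,x_{\tau_B})$. $V^+=\{x\in B^c:\sum_{z\in V}p(z\,|\,x)q(z)>0\}$, and $A\subseteq V^+$ under the standing assumption. $\delta_y$ is the delta function centered at $y$. *)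

theory Defs
  imports "HOL-Probability.Probability"
begin

definition distribution_on :: "'a set \<Rightarrow> ('a \<Rightarrow> real) \<Rightarrow> bool" where
  "distribution_on S f \<longleftrightarrow> finite S \<and> (\<forall>x\<in>S. 0 \<le> f x) \<and> (\<Sum>x\<in>S. f x) = 1"

definition delta :: "'a \<Rightarrow> 'a \<Rightarrow> real" where
  "delta y x = of_bool (x = y)"

text \<open>Throughout, \<open>p y x\<close> is the probability of a jump from \<open>x\<close> to \<open>y\<close>, written
  \<open>p(y | x)\<close> in informal notation: the target is the first argument.\<close>

definition stochastic_on :: "'a set \<Rightarrow> ('a \<Rightarrow> 'a \<Rightarrow> real) \<Rightarrow> bool" where
  "stochastic_on S p \<longleftrightarrow> (\<forall>x\<in>S. distribution_on S (\<lambda>y. p y x))"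

definition markov_chain ::
  "'w measure \<Rightarrow> (nat \<Rightarrow> 'w \<Rightarrow> 'a) \<Rightarrow> 'a set \<Rightarrow> ('a \<Rightarrow> 'a \<Rightarrow> real) \<Rightarrow> bool" where
  "markov_chain M X S p \<longleftrightarrow>
     prob_space M \<and>
     (\<forall>k. X k \<in> M \<rightarrow>\<^sub>M count_space S) \<and>
     (\<forall>k a. \<forall>y\<in>S. \<P>(\<omega> in M. \<forall>i\<le>k. X i \<omega> = a i) > 0 \<longrightarrow>
        \<P>(\<omega> in M. X (Suc k) \<omega> = y \<bar> \<forall>i\<le>k. X i \<omega> = a i) = p y (a k))"

text \<open>When \<open>f\<close> is a distribution on \<open>D\<close>, its masses add up to one, so this fixes the law of
  \<open>X 0\<close> completely.\<close>

definition initial_distribution ::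
  "'w measure \<Rightarrow> (nat \<Rightarrow> 'w \<Rightarrow> 'a) \<Rightarrow> 'a set \<Rightarrow> ('a \<Rightarrow> real) \<Rightarrow> bool" where
  "initial_distribution M X D f \<longleftrightarrow> (\<forall>x\<in>D. \<P>(\<omega> in M. X 0 \<omega> = x) = f x)"

text \<open>The canonical law of the chain with initial distribution \<open>f\<close> and transition
  probabilities \<open>p\<close>, a measure on sequences in \<open>S\<close>. It is the Ionescu-Tulcea limit of the
  kernels below; lemma \<open>path_measure_chain\<close> shows that it is what it should be.\<close>

definition path_kernel ::
  "'a set \<Rightarrow> ('a \<Rightarrow> 'a \<Rightarrow> real) \<Rightarrow> ('a \<Rightarrow> real) \<Rightarrow> nat \<Rightarrow> (nat \<Rightarrow> 'a) \<Rightarrow> 'a measure" where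
  "path_kernel S p f k \<omega> =
     point_measure S (\<lambda>y. ennreal (case k of 0 \<Rightarrow> f y | Suc j \<Rightarrow> p y (\<omega> j)))"

definition path_measure ::
  "'a set \<Rightarrow> ('a \<Rightarrow> 'a \<Rightarrow> real) \<Rightarrow> ('a \<Rightarrow> real) \<Rightarrow> (nat \<Rightarrow> 'a) measure" where
  "path_measure S p f =
     projective_family.lim UNIV
       (Ionescu_Tulcea.CI (path_kernel S p f) (\<lambda>_. count_space S)) (\<lambda>_. count_space S)"

definition hit :: "'a set \<Rightarrow> (nat \<Rightarrow> 'a) \<Rightarrow> enat" where
  "hit T x = (INF k\<in>{k. x k \<in> T}. enat k)"

definition reachable ::
  "'a set \<Rightarrow> ('a \<Rightarrow> 'a \<Rightarrow> real) \<Rightarrow> 'a set \<Rightarrow> 'a set \<Rightarrow> 'a set \<Rightarrow> 'a \<Rightarrow> bool" where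
  "reachable V p A B T x \<longleftrightarrow>
     (\<exists>k u. u 0 = x \<and> u k \<in> T \<and> (\<forall>l. 1 \<le> l \<and> l < k \<longrightarrow> u l \<in> V - (A \<union> B)) \<and>
        (\<forall>l<k. p (u (Suc l)) (u l) > 0))"

definition committor ::
  "'a set \<Rightarrow> ('a \<Rightarrow> 'a \<Rightarrow> real) \<Rightarrow> 'a set \<Rightarrow> 'a set \<Rightarrow> 'a \<Rightarrow> real" where
  "committor V p A B x = \<P>(\<omega> in path_measure V p (delta x). hit B \<omega> < hit A \<omega>)"

definition V_plus ::
  "'a set \<Rightarrow> ('a \<Rightarrow> 'a \<Rightarrow> real) \<Rightarrow> 'a set \<Rightarrow> 'a set \<Rightarrow> 'a set" where
  "V_plus V p A B = {x \<in> V - B. (\<Sum>z\<in>V. p z x * committor V p A B z) > 0}"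

text \<open>Meaningful if \<open>x 0 \<in> A\<close> and \<open>hit B x < \<infinity>\<close>.\<close>

definition last_hit :: "'a set \<Rightarrow> 'a set \<Rightarrow> (nat \<Rightarrow> 'a) \<Rightarrow> nat" where
  "last_hit A B x = Max {l. x l \<in> A \<and> enat l < hit B x}"

text \<open>The value \<open>[]\<close> is a dummy for \<open>hit B x = \<infinity>\<close>: if \<open>hit B x < \<infinity>\<close> (and, for the
  reactive trajectory, \<open>x 0 \<in> A\<close>), then the lists below are nonempty and end at the first
  visit to \<open>B\<close>.\<close>

definition stopped_path :: "'a set \<Rightarrow> (nat \<Rightarrow> 'a) \<Rightarrow> 'a list" where
  "stopped_path B x =
     (if hit B x < \<infinity> then map x [0..<Suc (the_enat (hit B x))] else [])"

definition reactive_trajectory :: "'a set \<Rightarrow> 'a set \<Rightarrow> (nat \<Rightarrow> 'a) \<Rightarrow> 'a list" where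
  "reactive_trajectory A B x =
     (if hit B x < \<infinity> then map x [last_hit A B x..<Suc (the_enat (hit B x))] else [])"

definition reactive_initial ::
  "'w measure \<Rightarrow> (nat \<Rightarrow> 'w \<Rightarrow> 'a) \<Rightarrow> 'a set \<Rightarrow> 'a set \<Rightarrow> 'a \<Rightarrow> real" where
  "reactive_initial M X A B x =
     \<P>(\<omega> in M. X (last_hit A B (\<lambda>k. X k \<omega>)) \<omega> = x)"

text \<open>Only the values for \<open>y \<in> V_plus V p A B \<union> B\<close> matter.\<close>

definition reactive_transition ::
  "'a set \<Rightarrow> ('a \<Rightarrow> 'a \<Rightarrow> real) \<Rightarrow> 'a set \<Rightarrow> 'a set \<Rightarrow> 'a \<Rightarrow> 'a \<Rightarrow> real" where
  "reactive_transition V p A B x y =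
     (let q = committor V p A B in
      if y \<in> B then delta y x
      else if y \<in> A then p x y * q x / (\<Sum>z\<in>V. p z y * q z)
      else p x y * q x / q y)"

lemma Ionescu_Tulcea_path_kernel:
  assumes f: "distribution_on S f" and p: "stochastic_on S p"
  shows "Ionescu_Tulcea (path_kernel S p f) (\<lambda>_. count_space S)"
proof (rule Ionescu_Tulcea.intro)
  have fin: "finite S" using f by (simp add: distribution_on_def)
  have ps: "prob_space (point_measure S (\<lambda>y. ennreal (g y)))" if "distribution_on S g" for g
    using that
    by (intro prob_spaceI) (simp add: space_point_measure emeasure_point_measure_finite
        distribution_on_def sum_ennreal)
  have dist: "distribution_on S (\<lambda>y. case i of 0 \<Rightarrow> f y | Suc j \<Rightarrow> p y (x j))"
    if "x \<in> space (Pi\<^sub>M {0..<i} (\<lambda>_. count_space S))" for i x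
    using that f p by (cases i) (auto simp: stochastic_on_def space_PiM)
  show "prob_space (path_kernel S p f i x)"
    if "x \<in> space (Pi\<^sub>M {0..<i} (\<lambda>_. count_space S))" for i x
    unfolding path_kernel_def by (rule ps[OF dist[OF that]])
  show "path_kernel S p f i \<in>
      Pi\<^sub>M {0..<i} (\<lambda>_. count_space S) \<rightarrow>\<^sub>M subprob_algebra (count_space S)" for i
  proof (cases i)
    case 0
    have "point_measure S (\<lambda>y. ennreal (f y)) \<in> space (subprob_algebra (count_space S))"
      using ps[OF f] by (simp add: space_subprob_algebra prob_space_imp_subprob_space
          sets_point_measure)
    then show ?thesis using 0 by (simp add: path_kernel_def[abs_def])
  next
    case (Suc j)
    have m: "(\<lambda>\<omega>. \<omega> j) \<in> Pi\<^sub>M {0..<i} (\<lambda>_. count_space S) \<rightarrow>\<^sub>M count_space S"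
      using Suc by (intro measurable_component_singleton) auto
    have "(\<lambda>x. point_measure S (\<lambda>y. ennreal (p y x))) \<in>
        count_space S \<rightarrow>\<^sub>M subprob_algebra (count_space S)"
      using p ps by (auto simp: space_subprob_algebra prob_space_imp_subprob_space
          sets_point_measure stochastic_on_def)
    from measurable_compose[OF m this] show ?thesis
      using Suc by (simp add: path_kernel_def[abs_def])
  qed
qed

lemma path_measure_cylinder:
  assumes f: "distribution_on S f" and p: "stochastic_on S p" and a: "\<And>i. i \<le> k \<Longrightarrow> a i \<in> S"
  shows "emeasure (path_measure S p f) {\<omega> \<in> space (path_measure S p f). \<forall>i\<le>k. \<omega> i = a i} =
    ennreal (f (a 0) * (\<Prod>i<k. p (a (Suc i)) (a i)))"
proof -
  interpret IT: Ionescu_Tulcea "path_kernel S p f" "\<lambda>_. count_space S"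
    by (rule Ionescu_Tulcea_path_kernel[OF f p])
  let ?M = "\<lambda>n::nat. Pi\<^sub>M {0..<n} (\<lambda>_. count_space S)"
  have fin: "finite S" using f by (simp add: distribution_on_def)
  have single: "{restrict b {0..<n}} \<in> sets (?M n)" if "\<And>i. i < n \<Longrightarrow> b i \<in> S" for n and b :: "nat \<Rightarrow> 'a"
  proof -
    have "{restrict b {0..<n}} = Pi\<^sub>E {0..<n} (\<lambda>i. {b i})"
      by (rule set_eqI) (fastforce simp: PiE_iff extensional_def restrict_def fun_eq_iff)
    also have "\<dots> \<in> sets (?M n)" using that by (intro sets_PiM_I_finite) simp_all
    finally show ?thesis .
  qed
  have C: "emeasure (IT.C 0 (Suc n) (\<lambda>_. undefined)) {restrict a {0..<Suc n}} =
      ennreal (f (a 0) * (\<Prod>i<n. p (a (Suc i)) (a i)))" if "n \<le> k" for n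
    using that
  proof (induction n)
    case 0
    have "IT.C 0 (Suc 0) (\<lambda>_. undefined) = IT.eP 0 (\<lambda>_. undefined)"
      using bind_return[OF IT.measurable_eP[of 0], of "\<lambda>_. undefined"] by (simp add: space_PiM)
    moreover have "(\<lambda>x. (\<lambda>_. undefined)(0 := x)) -` {restrict a {0..<Suc 0}} \<inter> S = {a 0}"
      using a[of 0] by (auto simp: fun_eq_iff split: if_splits)
    moreover have "{restrict a {0..<Suc 0}} \<in> sets (?M (Suc 0))" using a by (intro single) auto
    then have "emeasure (IT.eP 0 (\<lambda>_. undefined)) {restrict a {0..<Suc 0}} =
        emeasure (path_kernel S p f 0 (\<lambda>_. undefined))
          ((\<lambda>x. (\<lambda>_. undefined)(0 := x)) -` {restrict a {0..<Suc 0}} \<inter> S)"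
      by (subst IT.emeasure_eP) (simp_all add: space_PiM)
    ultimately show ?case using a[of 0] fin
      by (simp add: path_kernel_def[of _ _ _ 0] emeasure_point_measure_finite restrict_def
          del: IT.C.simps)
  next
    case (Suc n)
    let ?r = "restrict a {0..<Suc (Suc n)}" and ?s = "restrict a {0..<Suc n}"
    have r: "{?r} \<in> sets (?M (Suc (Suc n)))" and s: "{?s} \<in> sets (?M (Suc n))"
      using Suc.prems a by (auto intro!: single)
    have eq: "emeasure (IT.eP (Suc n) \<omega>) {?r} =
        ennreal (p (a (Suc n)) (a n)) * indicator {?s} \<omega>"
      if w: "\<omega> \<in> space (?M (Suc n))" for \<omega>
    proof -
      have "(fun_upd \<omega> (Suc n)) -` {?r} \<inter> S = (if \<omega> = ?s then {a (Suc n)} else {})"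
      proof (cases "\<omega> = ?s")
        case True
        then show ?thesis using a[of "Suc n"] Suc.prems
          by (auto simp: fun_eq_iff split: if_splits) (metis less_SucI)
      next
        case False
        then obtain i where i: "\<omega> i \<noteq> ?s i" by (auto simp: fun_eq_iff)
        have "i < Suc n"
        proof (rule ccontr)
          assume "\<not> i < Suc n"
          then have "\<omega> i = undefined" using w by (simp add: space_PiM PiE_iff extensional_def)
          with i \<open>\<not> i < Suc n\<close> show False by auto
        qed
        then have "fun_upd \<omega> (Suc n) y i \<noteq> ?r i" for y using i by auto
        then have "fun_upd \<omega> (Suc n) y \<noteq> ?r" for y by metis
        with False show ?thesis by auto
      qed
      moreover have "a (Suc n) \<in> S" using a Suc.prems by auto
      ultimately show ?thesis
        using IT.emeasure_eP[OF w r] fin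
        by (auto simp: path_kernel_def emeasure_point_measure_finite)
    qed
    have sp: "(\<lambda>_. undefined) \<in> space (?M 0)" by (simp add: space_PiM)
    have "emeasure (IT.C 0 (Suc (Suc n)) (\<lambda>_. undefined)) {?r} =
        (\<integral>\<^sup>+ \<omega>. emeasure (IT.eP (Suc n) \<omega>) {?r} \<partial>IT.C 0 (Suc n) (\<lambda>_. undefined))"
      using r IT.measurable_eP[of "Suc n"] sp a[of 0]
      by (simp only: IT.C.simps(2)[of _ "Suc n"] add_0)
        (intro emeasure_bind[where N = "?M (Suc (Suc n))"],
          auto simp: IT.space_C IT.sets_C measurable_cong_sets[OF IT.sets_C[OF sp] refl]
            simp del: IT.C.simps)
    also have "\<dots> = (\<integral>\<^sup>+ \<omega>. ennreal (p (a (Suc n)) (a n)) * indicator {?s} \<omega>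
        \<partial>IT.C 0 (Suc n) (\<lambda>_. undefined))"
      using eq by (intro nn_integral_cong) (simp add: IT.space_C[OF sp] del: IT.C.simps)
    also have "\<dots> = ennreal (p (a (Suc n)) (a n)) *
        emeasure (IT.C 0 (Suc n) (\<lambda>_. undefined)) {?s}"
      using s by (intro nn_integral_cmult_indicator) (simp add: IT.sets_C[OF sp] del: IT.C.simps)
    also have "\<dots> = ennreal (p (a (Suc n)) (a n)) *
        ennreal (f (a 0) * (\<Prod>i<n. p (a (Suc i)) (a i)))"
      using Suc.prems by (subst Suc.IH) simp_all
    also have "\<dots> = ennreal (f (a 0) * (\<Prod>i<Suc n. p (a (Suc i)) (a i)))"
    proof -
      have "p (a (Suc n)) (a n) \<ge> 0"
        using p a[of n] a[of "Suc n"] Suc.prems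
        by (auto simp: stochastic_on_def distribution_on_def)
      then show ?thesis by (simp add: ennreal_mult'[symmetric] ac_simps)
    qed
    finally show ?case .
  qed
  let ?a = "restrict a {0..<Suc k}"
  have sa: "{?a} \<in> sets (?M (Suc k))" using a by (intro single) auto
  have "IT.PF.emb UNIV {0..<Suc k} {?a} =
      {\<omega> \<in> space (path_measure S p f). \<forall>i\<le>k. \<omega> i = a i}"
    by (auto simp: path_measure_def IT.PF.space_lim prod_emb_def fun_eq_iff restrict_def
        space_PiM less_Suc_eq_le split: if_splits)
  moreover have "IT.CI {0..<Suc k} {?a} = IT.C 0 (Suc k) (\<lambda>_. undefined) {?a}"
  proof -
    have "IT.PF.emb {0..<Suc k} {0..<Suc k} {?a} = {?a}"
      using a by (intro prod_emb_id) (auto simp: less_Suc_eq_le)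
    with IT.emeasure_CI[of "{0..<Suc k}" "Suc k", OF _ sa] show ?thesis by simp
  qed
  ultimately show ?thesis
    using IT.lim[OF _ sa] C[of k] by (simp add: path_measure_def del: IT.C.simps)
qed

lemma path_measure_chain:
  assumes f: "distribution_on S f" and p: "stochastic_on S p"
  shows "markov_chain (path_measure S p f) (\<lambda>k \<omega>. \<omega> k) S p"
    and "initial_distribution (path_measure S p f) (\<lambda>k \<omega>. \<omega> k) S f"
proof -
  interpret IT: Ionescu_Tulcea "path_kernel S p f" "\<lambda>_. count_space S"
    by (rule Ionescu_Tulcea_path_kernel[OF f p])
  let ?P = "path_measure S p f"
  have sets: "sets ?P = sets (Pi\<^sub>M UNIV (\<lambda>_. count_space S))"
    by (simp add: path_measure_def)
  then have space: "space ?P = Pi\<^sub>E UNIV (\<lambda>_. S)"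
    by (simp add: sets_eq_imp_space_eq space_PiM)
  have prob: "prob_space ?P"
  proof (rule prob_spaceI)
    have "emeasure ?P (IT.PF.emb UNIV {} {\<lambda>_. undefined}) = IT.CI {} {\<lambda>_. undefined}"
      unfolding path_measure_def by (intro IT.lim) (simp_all add: PiM_empty)
    moreover have "IT.PF.emb UNIV {} {\<lambda>_. undefined} = space ?P"
      by (auto simp: prod_emb_def space restrict_def)
    moreover have "IT.CI {} {\<lambda>_. undefined} = 1"
      using prob_space.emeasure_space_1[OF IT.PF.prob_space_P[of "{}"]]
      by (simp add: IT.PF.space_P space_PiM)
    ultimately show "emeasure ?P (space ?P) = 1" by simp
  qed
  have nonneg: "f x \<ge> 0" "p y x \<ge> 0" if "x \<in> S" "y \<in> S" for x y
    using f p that by (auto simp: distribution_on_def stochastic_on_def)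
  have cyl: "\<P>(\<omega> in ?P. \<forall>i\<le>k. \<omega> i = a i) = f (a 0) * (\<Prod>i<k. p (a (Suc i)) (a i))"
    if "\<And>i. i \<le> k \<Longrightarrow> a i \<in> S" for k a
    using that
    by (simp add: measure_def path_measure_cylinder[OF f p], intro enn2real_ennreal
        mult_nonneg_nonneg prod_nonneg) (auto intro!: nonneg)
  show "initial_distribution ?P (\<lambda>k \<omega>. \<omega> k) S f"
    by (simp add: initial_distribution_def cyl[of 0 "\<lambda>_. x" for x, simplified])
  show "markov_chain ?P (\<lambda>k \<omega>. \<omega> k) S p"
    unfolding markov_chain_def
  proof (intro conjI allI ballI impI prob)
    show "(\<lambda>\<omega>. \<omega> k) \<in> ?P \<rightarrow>\<^sub>M count_space S" for k
      by (subst measurable_cong_sets[OF sets refl])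
        (intro measurable_component_singleton UNIV_I)
    fix k a y
    assume y: "y \<in> S" and pos: "0 < \<P>(\<omega> in ?P. \<forall>i\<le>k. \<omega> i = a i)"
    then have "{\<omega> \<in> space ?P. \<forall>i\<le>k. \<omega> i = a i} \<noteq> {}" by (metis measure_empty less_irrefl)
    then have a: "a i \<in> S" if "i \<le> k" for i using that by (auto simp: space PiE_iff) metis
    let ?b = "a(Suc k := y)"
    have "\<P>(\<omega> in ?P. \<omega> (Suc k) = y \<and> (\<forall>i\<le>k. \<omega> i = a i)) = \<P>(\<omega> in ?P. \<forall>i\<le>Suc k. \<omega> i = ?b i)"
      by (rule arg_cong[where f = "measure ?P"]) (auto simp: le_Suc_eq)
    also have "\<dots> = f (a 0) * (\<Prod>i<k. p (a (Suc i)) (a i)) * p y (a k)"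
    proof -
      have "(\<Prod>i<k. p (?b (Suc i)) (?b i)) = (\<Prod>i<k. p (a (Suc i)) (a i))"
        by (intro prod.cong) auto
      moreover have "?b i \<in> S" if "i \<le> Suc k" for i using that a y by (auto simp: le_Suc_eq)
      ultimately show ?thesis using cyl[of "Suc k" ?b] by simp
    qed
    also have "\<dots> = \<P>(\<omega> in ?P. \<forall>i\<le>k. \<omega> i = a i) * p y (a k)"
      using cyl[of k a] a by simp
    finally show "\<P>(\<omega> in ?P. \<omega> (Suc k) = y \<bar> \<forall>i\<le>k. \<omega> i = a i) = p y (a k)"
      using pos by (simp add: cond_prob_def)
  qed
qed

end

theory Submission
  imports Defs
begin

text \<open>
  The Markov property factors the probability that the reactive trajectory is
  \<open>a # ys @ [b]\<close> and starts at time \<open>l\<close>: it is the probability of being at \<open>a\<close> at time \<open>l\<close>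
  before hitting \<open>B\<close>, times the product of the jump probabilities along the list. Summing
  over \<open>l\<close> gives \<open>G a\<close> times that product, where \<open>G a\<close> is the expected number of visits to \<open>a\<close>
  before \<open>B\<close>. Summing also over all lists that start at \<open>a\<close> gives
  \<open>\<mu>\<^sub>r a = G a * (\<Sum>z. p z a * q z)\<close>. For the reactive chain the factors \<open>q\<close> telescope
  along the list, and \<open>\<mu>\<^sub>r a\<close> divided by the normalisation at \<open>a\<close> is again \<open>G a\<close>. The lists
  \<open>a # ys @ [b]\<close> already carry the full mass of the reactive trajectory, because \<open>B\<close> is hit
  almost surely; hence the two laws agree everywhere and the reactive chain hits \<open>B\<close> as well.
\<close>

section \<open>Cylinder probabilities of a Markov chain\<close>

text \<open>The probability that the chain started at \<open>x\<close> is in \<open>Ds ! j\<close> at every time \<open>j < length Ds\<close>.\<close>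

fun cyl :: "'a set \<Rightarrow> ('a \<Rightarrow> 'a \<Rightarrow> real) \<Rightarrow> 'a set list \<Rightarrow> 'a \<Rightarrow> real" where
  "cyl S p [] x = 1"
| "cyl S p (D # Ds) x = of_bool (x \<in> D) * (\<Sum>y\<in>S. p y x * cyl S p Ds y)"

lemma stochastic_onD:
  assumes "stochastic_on S p" "x \<in> S"
  shows "finite S" "\<And>y. y \<in> S \<Longrightarrow> 0 \<le> p y x" "(\<Sum>y\<in>S. p y x) = 1"
  using assms by (auto simp: stochastic_on_def distribution_on_def)

lemma cyl_nonneg:
  assumes "stochastic_on S p" "x \<in> S"
  shows "0 \<le> cyl S p Ds x"
  using assms(2)
proof (induction Ds arbitrary: x)
  case (Cons D Ds)
  then show ?case
    by (auto intro!: sum_nonneg mult_nonneg_nonneg stochastic_onD(2)[OF assms(1)])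
qed simp

lemma cyl_mono:
  assumes "stochastic_on S p" "x \<in> S" "list_all2 (\<subseteq>) Ds Es"
  shows "cyl S p Ds x \<le> cyl S p Es x"
  using assms(3,2)
proof (induction Ds Es arbitrary: x rule: list_all2_induct)
  case (Cons D Ds E Es)
  have "(\<Sum>y\<in>S. p y x * cyl S p Ds y) \<le> (\<Sum>y\<in>S. p y x * cyl S p Es y)"
    using Cons by (auto intro!: sum_mono mult_left_mono stochastic_onD(2)[OF assms(1)])
  moreover have "0 \<le> (\<Sum>y\<in>S. p y x * cyl S p Ds y)"
    using Cons.prems by (auto intro!: sum_nonneg mult_nonneg_nonneg stochastic_onD(2)[OF assms(1)]
        cyl_nonneg[OF assms(1)])
  ultimately show ?case using Cons.hyps by auto
qed simp

text \<open>At the entry \<open>{x}\<close> the position is forced, so what follows starts afresh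
  from \<open>x\<close>. In the base case \<open>cyl S p [{x}] y\<close> is the indicator of
  \<open>y = x\<close>, since the jump probabilities out of \<open>x\<close> sum to one.\<close>

lemma cyl_append_singleton:
  "cyl S p (Ds @ {x} # Es) y = cyl S p (Ds @ [{x}]) y * (\<Sum>z\<in>S. p z x * cyl S p Es z)"
  if "stochastic_on S p" "x \<in> S"
proof (induction Ds arbitrary: y)
  case Nil
  then show ?case using stochastic_onD(3)[OF that] by auto
next
  case (Cons D Ds)
  then show ?case by (simp add: sum_distrib_right mult.assoc)
qed

text \<open>Product form of the Markov property. It also covers histories of probability zero, where
  both sides vanish by monotonicity.\<close>

lemma markov_chain_step:
  assumes "markov_chain M X S p" "y \<in> S"
  shows "\<P>(\<omega> in M. (\<forall>i\<le>k. X i \<omega> = a i) \<and> X (Suc k) \<omega> = y) =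
    \<P>(\<omega> in M. \<forall>i\<le>k. X i \<omega> = a i) * p y (a k)"
proof -
  interpret prob_space M using assms by (simp add: markov_chain_def)
  have [measurable]: "X i \<in> M \<rightarrow>\<^sub>M count_space S" for i
    using assms by (simp add: markov_chain_def)
  have [measurable]: "Measurable.pred M (\<lambda>\<omega>. X i \<omega> = a i)" for i
    by (rule measurable_compose[of "X i" _ "count_space S"]) simp_all
  show ?thesis
  proof (cases "\<P>(\<omega> in M. \<forall>i\<le>k. X i \<omega> = a i) = 0")
    case True
    have "\<P>(\<omega> in M. (\<forall>i\<le>k. X i \<omega> = a i) \<and> X (Suc k) \<omega> = y)
        \<le> \<P>(\<omega> in M. \<forall>i\<le>k. X i \<omega> = a i)"
      by (intro finite_measure_mono) auto
    with True show ?thesis by (simp add: measure_le_0_iff)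
  next
    case False
    then have "\<P>(\<omega> in M. \<forall>i\<le>k. X i \<omega> = a i) > 0" by (simp add: zero_less_measure_iff)
    with assms have "\<P>(\<omega> in M. X (Suc k) \<omega> = y \<bar> \<forall>i\<le>k. X i \<omega> = a i) = p y (a k)"
      by (auto simp: markov_chain_def)
    with False show ?thesis by (simp add: cond_prob_def field_simps conj_commute)
  qed
qed

lemma markov_chain_pred:
  assumes "markov_chain M X S p"
  shows "Measurable.pred M (\<lambda>\<omega>. X i \<omega> \<in> D)"
proof (rule measurable_compose[of "X i" _ "count_space S"])
  show "X i \<in> M \<rightarrow>\<^sub>M count_space S" using assms by (simp add: markov_chain_def)
qed simp

text \<open>Induction on \<open>Ds\<close> with \<open>k\<close> and \<open>a\<close> arbitrary: the
  state at the next time is absorbed into the history, at the cost of one use of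
  \<open>markov_chain_step\<close>.\<close>

lemma markov_chain_future:
  assumes "markov_chain M X S p" "stochastic_on S p" "finite S"
  shows "\<P>(\<omega> in M. (\<forall>i\<le>k. X i \<omega> = a i) \<and> (\<forall>j<length Ds. X (Suc k + j) \<omega> \<in> Ds ! j)) =
    \<P>(\<omega> in M. \<forall>i\<le>k. X i \<omega> = a i) * (\<Sum>y\<in>S. p y (a k) * cyl S p Ds y)"
proof -
  interpret prob_space M using assms by (simp add: markov_chain_def)
  note [measurable] = markov_chain_pred[OF assms(1)]
  have [measurable]: "Measurable.pred M (\<lambda>\<omega>. X i \<omega> = z)" for i z
    using markov_chain_pred[OF assms(1), of i "{z}"] by simp
  have S: "X i \<omega> \<in> S" if "\<omega> \<in> space M" for i \<omega>
    using assms(1) that measurable_space[of "X i" M "count_space S"]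
    by (simp add: markov_chain_def)
  show ?thesis
  proof (induction Ds arbitrary: k a)
    case Nil
    show ?case
    proof (cases "a k \<in> S")
      case True
      then show ?thesis using stochastic_onD(3)[OF assms(2)] by simp
    next
      \<comment> \<open>Nothing is known of the jump probabilities out of a point outside
        \<open>S\<close>, but the chain stays in \<open>S\<close>, so such a history is
        null.\<close>
      case False
      have "{\<omega> \<in> space M. \<forall>i\<le>k. X i \<omega> = a i} = {}"
        using S[of _ k] False by (smt (verit) order_refl empty_Collect_eq)
      then have "\<P>(\<omega> in M. \<forall>i\<le>k. X i \<omega> = a i) = 0" by (simp only: measure_empty)
      then show ?thesis by simp
    qed
  next
    case (Cons D Ds)
    \<comment> \<open>Split by the state \<open>z\<close> at time \<open>Suc k\<close>; the update
      \<open>a(Suc k := z)\<close> makes it part of the history.\<close>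
    have "\<P>(\<omega> in M. (\<forall>i\<le>k. X i \<omega> = a i) \<and>
          (\<forall>j<length (D # Ds). X (Suc k + j) \<omega> \<in> (D # Ds) ! j)) =
        (\<Sum>z\<in>S. \<P>(\<omega> in M. z \<in> D \<and> (\<forall>i\<le>Suc k. X i \<omega> = (a(Suc k := z)) i) \<and>
          (\<forall>j<length Ds. X (Suc (Suc k) + j) \<omega> \<in> Ds ! j)))"
      by (rule prob_sum[OF assms(3)])
        (auto simp: All_less_Suc2 le_Suc_eq S intro!: AE_I2 split: if_splits)
    also have "\<dots> = (\<Sum>z\<in>S. of_bool (z \<in> D) *
        (\<P>(\<omega> in M. \<forall>i\<le>Suc k. X i \<omega> = (a(Suc k := z)) i) * (\<Sum>y\<in>S. p y z * cyl S p Ds y)))"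
    proof (rule sum.cong[OF refl])
      fix z
      show "\<P>(\<omega> in M. z \<in> D \<and> (\<forall>i\<le>Suc k. X i \<omega> = (a(Suc k := z)) i) \<and>
          (\<forall>j<length Ds. X (Suc (Suc k) + j) \<omega> \<in> Ds ! j)) = of_bool (z \<in> D) *
        (\<P>(\<omega> in M. \<forall>i\<le>Suc k. X i \<omega> = (a(Suc k := z)) i) * (\<Sum>y\<in>S. p y z * cyl S p Ds y))"
        using Cons[of "Suc k" "a(Suc k := z)"] by (cases "z \<in> D") (simp_all del: fun_upd_apply, simp)
    qed
    also have "\<dots> = (\<Sum>z\<in>S. \<P>(\<omega> in M. \<forall>i\<le>k. X i \<omega> = a i) * (p z (a k) * cyl S p (D # Ds) z))"
    proof (rule sum.cong[OF refl])
      fix z assume z: "z \<in> S"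
      have "\<P>(\<omega> in M. \<forall>i\<le>Suc k. X i \<omega> = (a(Suc k := z)) i) =
          \<P>(\<omega> in M. (\<forall>i\<le>k. X i \<omega> = a i) \<and> X (Suc k) \<omega> = z)"
        by (rule arg_cong[where f = "measure M"]) (auto simp: le_Suc_eq)
      then show "of_bool (z \<in> D) * (\<P>(\<omega> in M. \<forall>i\<le>Suc k. X i \<omega> = (a(Suc k := z)) i) *
          (\<Sum>y\<in>S. p y z * cyl S p Ds y)) =
          \<P>(\<omega> in M. \<forall>i\<le>k. X i \<omega> = a i) * (p z (a k) * cyl S p (D # Ds) z)"
        using markov_chain_step[OF assms(1) z, of k a] by simp
    qed
    finally show ?case by (simp add: sum_distrib_left)
  qed
qed

lemma markov_chain_cyl:
  assumes "markov_chain M X S p" "stochastic_on S p" "finite S"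
  shows "\<P>(\<omega> in M. \<forall>j<length Ds. X j \<omega> \<in> Ds ! j) =
    (\<Sum>x\<in>S. \<P>(\<omega> in M. X 0 \<omega> = x) * cyl S p Ds x)"
proof -
  interpret prob_space M using assms by (simp add: markov_chain_def)
  note [measurable] = markov_chain_pred[OF assms(1)]
  have [measurable]: "Measurable.pred M (\<lambda>\<omega>. X i \<omega> = z)" for i z
    using markov_chain_pred[OF assms(1), of i "{z}"] by simp
  have S: "X i \<omega> \<in> S" if "\<omega> \<in> space M" for i \<omega>
    using assms(1) that measurable_space[of "X i" M "count_space S"]
    by (simp add: markov_chain_def)
  show ?thesis
  proof (cases Ds)
    case Nil
    have "\<P>(\<omega> in M. True) = (\<Sum>x\<in>S. \<P>(\<omega> in M. X 0 \<omega> = x))"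
      by (rule prob_sum[OF assms(3)]) (auto simp: S intro!: AE_I2)
    then show ?thesis using Nil by simp
  next
    case (Cons D Es)
    have "\<P>(\<omega> in M. \<forall>j<length Ds. X j \<omega> \<in> Ds ! j) =
        (\<Sum>x\<in>S. \<P>(\<omega> in M. x \<in> D \<and> (\<forall>i\<le>0. X i \<omega> = x) \<and>
          (\<forall>j<length Es. X (Suc 0 + j) \<omega> \<in> Es ! j)))"
      unfolding Cons
      by (rule prob_sum[OF assms(3)]) (auto simp: All_less_Suc2 S intro!: AE_I2)
    also have "\<dots> = (\<Sum>x\<in>S. \<P>(\<omega> in M. X 0 \<omega> = x) * cyl S p Ds x)"
    proof (rule sum.cong[OF refl])
      fix x
      show "\<P>(\<omega> in M. x \<in> D \<and> (\<forall>i\<le>0. X i \<omega> = x) \<and>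
          (\<forall>j<length Es. X (Suc 0 + j) \<omega> \<in> Es ! j)) = \<P>(\<omega> in M. X 0 \<omega> = x) * cyl S p Ds x"
        using markov_chain_future[OF assms, of 0 "\<lambda>_. x" Es] Cons by (cases "x \<in> D") simp_all
    qed
    finally show ?thesis .
  qed
qed

section \<open>First passage paths\<close>

lemma enat_less_hit_iff: "enat l < hit T x \<longleftrightarrow> (\<forall>k\<le>l. x k \<notin> T)"
proof -
  have "hit T x \<le> enat l \<longleftrightarrow> (\<exists>k\<le>l. x k \<in> T)"
  proof
    assume "hit T x \<le> enat l"
    \<comment> \<open>\<open>INF_less_iff\<close> works with a strict bound, hence the passage from
      \<open>l\<close> to \<open>Suc l\<close>.\<close>
    then have "hit T x < enat (Suc l)" by (metis enat_ord_simps(2) lessI order_le_less_trans)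
    then show "\<exists>k\<le>l. x k \<in> T" by (auto simp: hit_def INF_less_iff less_Suc_eq_le)
  next
    assume "\<exists>k\<le>l. x k \<in> T"
    then show "hit T x \<le> enat l"
      by (auto simp: hit_def intro: INF_lower2)
  qed
  then show ?thesis by (metis not_le)
qed

lemma hit_eq_enat_iff: "hit T x = enat k \<longleftrightarrow> x k \<in> T \<and> (\<forall>i<k. x i \<notin> T)"
proof (cases k)
  case 0
  then show ?thesis using enat_less_hit_iff[of 0 T x]
    by (auto simp: zero_enat_def[symmetric])
next
  case (Suc j)
  have "hit T x = enat k \<longleftrightarrow> enat j < hit T x \<and> \<not> enat k < hit T x"
    by (cases "hit T x") (auto simp: Suc)
  then show ?thesis by (simp add: enat_less_hit_iff Suc less_Suc_eq_le) (metis le_Suc_eq)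
qed

lemma hit_finite_iff: "hit T x < \<infinity> \<longleftrightarrow> (\<exists>k. x k \<in> T)"
  unfolding hit_def INF_less_iff by auto

text \<open>The index \<open>k\<close> is the hitting time of \<open>T\<close>; disjointness rules
  out that \<open>T'\<close> is hit at that same time.\<close>

lemma hit_less_hit_iff:
  assumes "range x \<subseteq> S" "T \<inter> T' = {}"
  shows "hit T x < hit T' x \<longleftrightarrow> (\<exists>k. x k \<in> T \<and> (\<forall>i<k. x i \<in> S - (T' \<union> T)))"
proof
  assume less: "hit T x < hit T' x"
  then obtain k where k: "hit T x = enat k" by (cases "hit T x") auto
  with less have "\<forall>i\<le>k. x i \<notin> T'" by (simp add: enat_less_hit_iff)
  with k assms(1) show "\<exists>k. x k \<in> T \<and> (\<forall>i<k. x i \<in> S - (T' \<union> T))"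
    by (auto simp: hit_eq_enat_iff intro!: exI[of _ k])
next
  assume "\<exists>k. x k \<in> T \<and> (\<forall>i<k. x i \<in> S - (T' \<union> T))"
  then obtain k where k: "x k \<in> T" "\<forall>i<k. x i \<in> S - (T' \<union> T)" by blast
  then have "hit T x = enat k" by (auto simp: hit_eq_enat_iff)
  moreover have "enat k < hit T' x"
    using k assms(2) unfolding enat_less_hit_iff by (auto simp: le_less)
  ultimately show "hit T x < hit T' x" by simp
qed

lemma last_hit_eqI:
  assumes "hit B x = enat h" "x l \<in> A" "l < h" "\<And>i. l < i \<Longrightarrow> i < h \<Longrightarrow> x i \<notin> A"
  shows "last_hit A B x = l"
  unfolding last_hit_def assms(1)
  using assms(2-4) by (intro Max_eqI) (auto intro: finite_subset[of _ "{..<h}"] simp: not_less[symmetric])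

lemma last_hit_in:
  assumes "x 0 \<in> A" "A \<inter> B = {}" "hit B x = enat h"
  shows "x (last_hit A B x) \<in> A" "last_hit A B x < h"
    "\<And>i. last_hit A B x < i \<Longrightarrow> i < h \<Longrightarrow> x i \<notin> A"
proof -
  let ?L = "{l. x l \<in> A \<and> enat l < hit B x}"
  have fin: "finite ?L" by (rule finite_subset[of _ "{..<h}"]) (auto simp: assms(3))
  \<comment> \<open>The start lies in \<open>A\<close>, hence outside \<open>B\<close>, so
    \<open>h\<close> is positive and the maximum is taken over a set that contains 0.\<close>
  have "h \<noteq> 0" using assms by (auto simp: hit_eq_enat_iff intro!: Nat.gr0I)
  then have "0 \<in> ?L" using assms(1,3) by simp
  then have "last_hit A B x \<in> ?L" unfolding last_hit_def using fin by (intro Max_in) auto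
  then show "x (last_hit A B x) \<in> A" "last_hit A B x < h" by (simp_all add: assms(3))
  fix i assume i: "last_hit A B x < i" "i < h"
  show "x i \<notin> A"
  proof
    assume "x i \<in> A"
    then have "i \<le> last_hit A B x"
      unfolding last_hit_def using fin i by (intro Max_ge) (simp_all add: assms(3))
    with i show False by simp
  qed
qed

text \<open>The possible values of the reactive trajectory of a path that starts in \<open>A\<close>
  and hits \<open>B\<close>; the two laws are compared on this set.\<close>

definition transition_lists :: "'a set \<Rightarrow> 'a set \<Rightarrow> 'a set \<Rightarrow> 'a list set" where
  "transition_lists S A B = {a # ys @ [b] | a ys b. a \<in> A \<and> set ys \<subseteq> S - (A \<union> B) \<and> b \<in> B}"

text \<open>The last visit to \<open>A\<close> is not a stopping time. For fixed \<open>l\<close>,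
  however, the event splits into a past up to \<open>l\<close> and a future that enters
  \<open>B\<close> without returning to \<open>A\<close>, so the Markov property at the fixed time
  \<open>l\<close> applies.\<close>

lemma first_passage_iff:
  assumes "\<And>i. x i \<in> S" "A \<inter> B = {}" "x 0 \<in> A" "hit B x < \<infinity>"
  shows "x (last_hit A B x) = a \<and> l = last_hit A B x \<longleftrightarrow>
    a \<in> A \<and> x l = a \<and> (\<forall>i<l. x i \<notin> B) \<and>
    (\<exists>k. (\<forall>i<k. x (Suc l + i) \<in> S - (A \<union> B)) \<and> x (Suc l + k) \<in> B)" (is "?L \<longleftrightarrow> ?R")
proof
  obtain h where h: "hit B x = enat h" using assms(4) by (cases "hit B x") auto
  note last = last_hit_in[OF assms(3,2) h]
  assume ?L
  \<comment> \<open>The witness for \<open>k\<close> is \<open>h - Suc l\<close>, the number of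
    points strictly between the last visit to \<open>A\<close> and the arrival in
    \<open>B\<close>.\<close>
  moreover from this have "(\<forall>i<h - Suc l. x (Suc l + i) \<in> S - (A \<union> B)) \<and>
      x (Suc l + (h - Suc l)) \<in> B"
    using last h assms(1) by (auto simp: hit_eq_enat_iff)
  ultimately show ?R using last h by (auto simp: hit_eq_enat_iff)
next
  assume ?R
  then obtain k where k: "a \<in> A" "x l = a" "\<forall>i<l. x i \<notin> B"
    "\<forall>i<k. x (Suc l + i) \<in> S - (A \<union> B)" "x (Suc l + k) \<in> B" by blast
  have *: "x i \<in> S - (A \<union> B)" if "l < i" "i < Suc l + k" for i
    using k(4)[rule_format, of "i - Suc l"] that by simp
  have "x i \<notin> B" if "i < Suc l + k" for i
    using *[of i] that k assms(2) by (cases i l rule: linorder_cases) auto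
  then have "hit B x = enat (Suc l + k)" using k(5) unfolding hit_eq_enat_iff by blast
  then have "last_hit A B x = l" using k(1,2) * by (intro last_hit_eqI) auto
  with k show ?L by simp
qed

lemma reactive_trajectory_in_transition_lists:
  assumes "\<And>i. x i \<in> S" "A \<inter> B = {}" "x 0 \<in> A" "hit B x < \<infinity>"
  shows "reactive_trajectory A B x \<in> transition_lists S A B"
proof -
  obtain h where h: "hit B x = enat h" using assms(4) by (cases "hit B x") auto
  note last = last_hit_in[OF assms(3,2) h]
  let ?l = "last_hit A B x"
  have "[?l..<Suc h] = ?l # [Suc ?l..<h] @ [h]"
    using last(2) by (simp add: upt_conv_Cons)
  then have "reactive_trajectory A B x = x ?l # map x [Suc ?l..<h] @ [x h]"
    by (simp add: reactive_trajectory_def h)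
  moreover have "set (map x [Suc ?l..<h]) \<subseteq> S - (A \<union> B)"
    using last(3) assms(1) h by (auto simp: hit_eq_enat_iff)
  moreover have "x h \<in> B" using h by (simp add: hit_eq_enat_iff)
  ultimately show ?thesis using last(1) unfolding transition_lists_def by blast
qed

text \<open>The list itself leaves \<open>A\<close> at its first entry and meets \<open>B\<close>
  only at its last one, so following it from time \<open>l\<close> fixes the last visit and, with
  the past off \<open>B\<close>, the hitting time.\<close>

lemma reactive_trajectory_eq_iff:
  assumes "\<And>i. x i \<in> S" "A \<inter> B = {}" "x 0 \<in> A" "hit B x < \<infinity>" "xs \<in> transition_lists S A B"
  shows "reactive_trajectory A B x = xs \<and> l = last_hit A B x \<longleftrightarrow>
    (\<forall>i<l. x i \<notin> B) \<and> (\<forall>i<length xs. x (l + i) = xs ! i)" (is "?L \<longleftrightarrow> ?R")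
proof
  obtain h where h: "hit B x = enat h" using assms(4) by (cases "hit B x") auto
  note last = last_hit_in[OF assms(3,2) h]
  assume ?L
  then have l: "l = last_hit A B x" and xs: "xs = map x [l..<Suc h]"
    by (auto simp: reactive_trajectory_def h)
  show ?R using last(2) h unfolding xs l by (auto simp: hit_eq_enat_iff simp del: upt_Suc)
next
  assume R: ?R
  obtain a ys b where xs: "xs = a # ys @ [b]" "a \<in> A" "set ys \<subseteq> S - (A \<union> B)" "b \<in> B"
    using assms(5) unfolding transition_lists_def by blast
  have nth: "x (l + i) = xs ! i" if "i < length xs" for i using R that by simp
  have *: "x i \<in> S - (A \<union> B)" if "l < i" "i < Suc l + length ys" for i
  proof -
    define j where "j = i - Suc l"
    then have j: "i = l + Suc j" "j < length ys" using that by auto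
    then have "x i = ys ! j" using nth[of "Suc j"] by (simp add: xs(1) nth_append)
    moreover have "ys ! j \<in> set ys" using j by simp
    ultimately show ?thesis using xs(3) by auto
  qed
  have a: "x l = a" using nth[of 0] xs by simp
  have b: "x (Suc l + length ys) \<in> B" using nth[of "Suc (length ys)"] xs by (simp add: nth_append)
  have "x i \<notin> B" if "i < Suc l + length ys" for i
    using *[of i] that R a xs(2) assms(2) by (cases i l rule: linorder_cases) auto
  then have h: "hit B x = enat (Suc l + length ys)" using b unfolding hit_eq_enat_iff by blast
  then have last: "last_hit A B x = l" using xs(2) a * by (intro last_hit_eqI) auto
  have "map x [l..<Suc (Suc l + length ys)] = xs"
    using nth by (intro nth_equalityI) (auto simp: xs(1) simp del: upt_Suc)
  then show ?L using h last by (simp add: reactive_trajectory_def)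
qed

text \<open>Only the last entry of a transition list lies in \<open>B\<close>, so agreement along
  the list determines the hitting time.\<close>

lemma stopped_path_eq_iff:
  assumes "A \<inter> B = {}" "xs \<in> transition_lists S A B"
  shows "stopped_path B x = xs \<longleftrightarrow> (\<forall>i<length xs. x i = xs ! i)" (is "?L \<longleftrightarrow> ?R")
proof
  \<comment> \<open>This excludes the dummy value \<open>[]\<close> of a path that never hits
    \<open>B\<close>.\<close>
  have "xs \<noteq> []" using assms(2) by (auto simp: transition_lists_def)
  moreover assume ?L
  ultimately show ?R by (auto simp: stopped_path_def nth_append split: if_splits simp del: upt_Suc)
next
  assume R: ?R
  obtain a ys b where xs: "xs = a # ys @ [b]" "a \<in> A" "set ys \<subseteq> S - (A \<union> B)" "b \<in> B"
    using assms(2) unfolding transition_lists_def by blast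
  have "xs ! i \<notin> B" if "i < Suc (length ys)" for i
  proof (cases i)
    case (Suc j)
    then have "xs ! i = ys ! j" "ys ! j \<in> set ys" using that xs(1) by (auto simp: nth_append)
    then show ?thesis using xs(3) by auto
  qed (use xs assms(1) in auto)
  then have "x i \<notin> B" if "i < Suc (length ys)" for i using R xs(1) that by simp
  moreover have "x (Suc (length ys)) \<in> B" using R xs by (simp add: nth_append)
  ultimately have "hit B x = enat (Suc (length ys))" unfolding hit_eq_enat_iff by blast
  moreover have "map x [0..<Suc (Suc (length ys))] = xs"
    using R by (intro nth_equalityI) (auto simp: xs(1) simp del: upt_Suc)
  ultimately show ?L by (simp add: stopped_path_def)
qed

section \<open>Measurability of hitting times and path segments\<close>

lemma measurable_hit:
  assumes [measurable]: "\<And>i. Measurable.pred M (\<lambda>\<omega>. X i \<omega> \<in> B)"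
  shows "(\<lambda>\<omega>. hit B (\<lambda>k. X k \<omega>)) \<in> M \<rightarrow>\<^sub>M count_space UNIV"
proof -
  have "{\<omega> \<in> space M. hit B (\<lambda>k. X k \<omega>) = e} \<in> sets M" for e
  proof (cases e)
    case (enat k)
    have "{\<omega> \<in> space M. X k \<omega> \<in> B \<and> (\<forall>i<k. X i \<omega> \<notin> B)} \<in> sets M" by measurable
    then show ?thesis unfolding enat hit_eq_enat_iff .
  next
    case infinity
    have "(hit B (\<lambda>k. X k \<omega>) = \<infinity>) = (\<forall>k. X k \<omega> \<notin> B)" for \<omega>
      using hit_finite_iff[of B "\<lambda>k. X k \<omega>"] by (metis enat_ord_simps(4))
    moreover have "{\<omega> \<in> space M. \<forall>k. X k \<omega> \<notin> B} \<in> sets M" by measurable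
    ultimately show ?thesis unfolding infinity by (simp only:)
  qed
  moreover have "(\<lambda>\<omega>. hit B (\<lambda>k. X k \<omega>)) -` {e} \<inter> space M = {\<omega> \<in> space M. hit B (\<lambda>k. X k \<omega>) = e}" for e
    by blast
  ultimately show ?thesis
    by (simp only: measurable_count_space_eq2_countable) simp
qed

lemma measurable_last_hit:
  assumes [measurable]: "\<And>i. Measurable.pred M (\<lambda>\<omega>. X i \<omega> \<in> A)"
    "\<And>i. Measurable.pred M (\<lambda>\<omega>. X i \<omega> \<in> B)"
  shows "(\<lambda>\<omega>. last_hit A B (\<lambda>k. X k \<omega>)) \<in> M \<rightarrow>\<^sub>M count_space UNIV"
  unfolding last_hit_def enat_less_hit_iff by measurable

text \<open>The end points take countably many values. Fixing first \<open>h\<close> and then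
  \<open>l\<close> leaves a segment with constant end points, and there are only countably many
  lists to test.\<close>

lemma measurable_path_segment:
  fixes X :: "nat \<Rightarrow> 'w \<Rightarrow> 'a :: countable"
  assumes [measurable]: "\<And>i x. Measurable.pred M (\<lambda>\<omega>. X i \<omega> = x)"
    "l \<in> M \<rightarrow>\<^sub>M count_space UNIV" "h \<in> M \<rightarrow>\<^sub>M count_space UNIV"
  shows "(\<lambda>\<omega>. if h \<omega> < \<infinity> then map (\<lambda>k. X k \<omega>) [l \<omega>..<Suc (the_enat (h \<omega>))] else []) \<in>
    M \<rightarrow>\<^sub>M count_space UNIV"
proof (rule measurable_compose_countable'[where g = h and I = UNIV])
  have seg: "(\<lambda>\<omega>. map (\<lambda>k. X k \<omega>) [i..<j]) \<in> M \<rightarrow>\<^sub>M count_space UNIV" for i j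
  proof -
    have "{\<omega> \<in> space M. map (\<lambda>k. X k \<omega>) [i..<j] = xs} =
        {\<omega> \<in> space M. length xs = j - i \<and> (\<forall>m<j - i. X (i + m) \<omega> = xs ! m)}" for xs
      by (auto simp: list_eq_iff_nth_eq)
    then have "{\<omega> \<in> space M. map (\<lambda>k. X k \<omega>) [i..<j] = xs} \<in> sets M" for xs by simp
    then show ?thesis
      by (auto simp: measurable_count_space_eq2_countable vimage_def Int_def conj_commute)
  qed
  fix e :: enat
  show "(\<lambda>\<omega>. if e < \<infinity> then map (\<lambda>k. X k \<omega>) [l \<omega>..<Suc (the_enat e)] else []) \<in>
      M \<rightarrow>\<^sub>M count_space UNIV"
  proof (cases "e < \<infinity>")
    case True
    have "(\<lambda>\<omega>. map (\<lambda>k. X k \<omega>) [l \<omega>..<Suc (the_enat e)]) \<in> M \<rightarrow>\<^sub>M count_space UNIV"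
      by (rule measurable_compose_countable'[where g = l and I = UNIV, OF seg assms(2)]) simp
    with True show ?thesis by (simp del: upt_Suc)
  qed simp
qed auto

text \<open>Equal point masses on \<open>D\<close> give \<open>N\<close> the same mass on
  \<open>D\<close> as \<open>M\<close>, namely one. Hence nothing is left outside \<open>D\<close>,
  and full mass passes from \<open>M\<close> to \<open>N\<close>.\<close>

lemma measure_eqI_countable_full:
  fixes M N :: "'a :: countable measure"
  assumes "prob_space M" "prob_space N" "sets M = UNIV" "sets N = UNIV"
    and eq: "\<And>x. x \<in> D \<Longrightarrow> emeasure M {x} = emeasure N {x}" and "AE x in M. x \<in> D"
  shows "M = N" "AE x in N. x \<in> D"
proof -
  have "emeasure M D = (\<integral>\<^sup>+x. emeasure M {x} \<partial>count_space D)"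
    using assms(3) by (intro emeasure_countable_singleton) auto
  also have "\<dots> = (\<integral>\<^sup>+x. emeasure N {x} \<partial>count_space D)" by (intro nn_integral_cong) (simp add: eq)
  also have "\<dots> = emeasure N D"
    using assms(4) by (intro emeasure_countable_singleton[symmetric]) auto
  finally have "emeasure M D = emeasure N D" .
  moreover have "emeasure M D = 1"
    using assms(3,6) by (intro prob_space.emeasure_eq_1_AE[OF assms(1)]) auto
  ultimately show AE: "AE x in N. x \<in> D"
    using prob_space.AE_in_set_eq_1[OF assms(2), of D] assms(4) by (simp add: measure_def)
  show "M = N"
    using assms(3,4,6) AE eq by (intro measure_eqI_countable_AE[where \<Omega> = D]) auto
qed

section \<open>The committor and the reactive transition probabilities\<close>

lemma in_nth_append_iff:
  "(\<forall>j<length (Ds @ Es). f j \<in> (Ds @ Es) ! j) \<longleftrightarrow>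
    (\<forall>j<length Ds. f j \<in> Ds ! j) \<and> (\<forall>j<length Es. f (length Ds + j) \<in> Es ! j)" (is "?L \<longleftrightarrow> ?R")
proof
  assume L: ?L
  have "f j \<in> Ds ! j" if "j < length Ds" for j
    using L[rule_format, of j] that by (simp add: nth_append)
  moreover have "f (length Ds + j) \<in> Es ! j" if "j < length Es" for j
    using L[rule_format, of "length Ds + j"] that by (simp add: nth_append)
  ultimately show ?R by blast
next
  assume R: ?R
  have "f j \<in> (Ds @ Es) ! j" if "j < length (Ds @ Es)" for j
    using R[THEN conjunct1, rule_format, of j] R[THEN conjunct2, rule_format, of "j - length Ds"] that
    by (cases "j < length Ds") (auto simp: nth_append)
  then show ?L by blast
qed

lemma cyl_replicate_antimono:
  assumes "stochastic_on S p" "x \<in> S"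
  shows "cyl S p (replicate (Suc k) D) x \<le> cyl S p (replicate k D) x"
  using assms(2)
proof (induction k arbitrary: x)
  case 0
  then show ?case using stochastic_onD(3)[OF assms(1)] by simp
next
  case (Suc k)
  have "(\<Sum>y\<in>S. p y x * cyl S p (replicate (Suc k) D) y) \<le>
      (\<Sum>y\<in>S. p y x * cyl S p (replicate k D) y)"
    by (intro sum_mono mult_left_mono Suc.IH stochastic_onD(2)[OF assms(1) Suc.prems])
  then have "of_bool (x \<in> D) * (\<Sum>y\<in>S. p y x * cyl S p (replicate (Suc k) D) y) \<le>
      of_bool (x \<in> D) * (\<Sum>y\<in>S. p y x * cyl S p (replicate k D) y)"
    by (intro mult_left_mono) auto
  then show ?case by (simp only: replicate_Suc cyl.simps)
qed

text \<open>One-step maximum principle: the weighted gaps \<open>m - h y\<close> are nonnegative and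
  sum to zero, so each gap with positive weight vanishes.\<close>

lemma average_eq_max:
  fixes h :: "'a \<Rightarrow> real"
  assumes "stochastic_on S p" "x \<in> S" "\<And>y. y \<in> S \<Longrightarrow> h y \<le> m"
    and "(\<Sum>y\<in>S. p y x * h y) = m" "y \<in> S" "p y x > 0"
  shows "h y = m"
proof -
  have "(\<Sum>y\<in>S. p y x * (m - h y)) = 0"
    using assms(4) stochastic_onD(3)[OF assms(1,2)]
    by (simp add: right_diff_distrib sum_subtractf sum_distrib_right[symmetric])
  moreover have "\<forall>y\<in>S. 0 \<le> p y x * (m - h y)"
    using assms(3) stochastic_onD(2)[OF assms(1,2)] by simp
  ultimately have "p y x * (m - h y) = 0"
    using assms(5) stochastic_onD(1)[OF assms(1,2)]
      sum_nonneg_eq_0_iff[of S "\<lambda>y. p y x * (m - h y)"] by simp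
  with assms(6) show ?thesis by simp
qed

section \<open>The committor: series, boundary values and harmonicity\<close>

locale transition_problem =
  fixes V A B :: "'a :: countable set" and p :: "'a \<Rightarrow> 'a \<Rightarrow> real"
  assumes finite_V: "finite V" and stochastic: "stochastic_on V p"
    and A_subset: "A \<subseteq> V" and B_subset: "B \<subseteq> V" and disjoint: "A \<inter> B = {}"
    and reach_AB: "\<And>x. x \<in> V - (A \<union> B) \<Longrightarrow> reachable V p A B A x \<or> reachable V p A B B x"
    and reach_B: "\<And>x. x \<in> A \<Longrightarrow> reachable V p A B B x"
begin

abbreviation "C \<equiv> V - (A \<union> B)"
abbreviation "q \<equiv> committor V p A B"
abbreviation "s x \<equiv> \<Sum>z\<in>V. p z x * q z"

lemma p_nonneg: "x \<in> V \<Longrightarrow> y \<in> V \<Longrightarrow> 0 \<le> p y x"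
  by (rule stochastic_onD(2)[OF stochastic])

lemma p_sum: "x \<in> V \<Longrightarrow> (\<Sum>y\<in>V. p y x) = 1"
  by (rule stochastic_onD(3)[OF stochastic])

text \<open>The event that \<open>B\<close> comes before \<open>A\<close> is the disjoint union over
  \<open>k\<close> of staying in \<open>C\<close> for \<open>k\<close> steps and then being in
  \<open>B\<close>. All later facts on \<open>q\<close> are read off this series.\<close>

lemma committor_sums:
  assumes "x \<in> V"
  shows "(\<lambda>k. cyl V p (replicate k C @ [B]) x) sums q x"
proof -
  let ?P = "path_measure V p (delta x)"
  have dist: "distribution_on V (delta x)"
    using assms finite_V by (simp add: distribution_on_def delta_def)
  note chain = path_measure_chain[OF dist stochastic]
  interpret prob_space ?P using chain(1) by (simp add: markov_chain_def)
  note [measurable] = markov_chain_pred[OF chain(1)]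
  have V: "\<omega> i \<in> V" if "\<omega> \<in> space ?P" for \<omega> i
    using chain(1) that measurable_space[of "\<lambda>\<omega>. \<omega> i" ?P "count_space V"]
    by (simp add: markov_chain_def)
  let ?E = "\<lambda>k \<omega>. (\<forall>i<k. \<omega> i \<in> C) \<and> \<omega> k \<in> B"
  have "(\<lambda>k. \<P>(\<omega> in ?P. ?E k \<omega>)) sums \<P>(\<omega> in ?P. \<exists>k. ?E k \<omega>)"
  proof (rule prob_sums)
    have "k = l" if "?E k \<omega>" "?E l \<omega>" for k l :: nat and \<omega>
      using that by (cases k l rule: linorder_cases) auto
    then show "AE \<omega> in ?P. (\<forall>k. ?E k \<omega> \<longrightarrow> (\<exists>k. ?E k \<omega>)) \<and> ((\<exists>k. ?E k \<omega>) \<longrightarrow> (\<exists>!k. ?E k \<omega>))"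
      by (intro AE_I2) blast
  qed measurable
  moreover have "\<P>(\<omega> in ?P. ?E k \<omega>) = cyl V p (replicate k C @ [B]) x" for k
  proof -
    have "\<P>(\<omega> in ?P. ?E k \<omega>) =
        \<P>(\<omega> in ?P. \<forall>j<length (replicate k C @ [B]). \<omega> j \<in> (replicate k C @ [B]) ! j)"
      unfolding in_nth_append_iff by (simp cong: conj_cong)
    also have "\<dots> = (\<Sum>y\<in>V. delta x y * cyl V p (replicate k C @ [B]) y)"
      using chain(2)
      by (subst markov_chain_cyl[OF chain(1) stochastic finite_V]) (simp add: initial_distribution_def)
    also have "\<dots> = cyl V p (replicate k C @ [B]) x"
      using assms finite_V by (simp add: delta_def of_bool_def if_distrib[of "\<lambda>c. c * _"] cong: if_cong)
    finally show ?thesis .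
  qed
  moreover have "hit B \<omega> < hit A \<omega> \<longleftrightarrow> (\<exists>k. ?E k \<omega>)" if "\<omega> \<in> space ?P" for \<omega>
  proof -
    have "range \<omega> \<subseteq> V" using V[OF that] by auto
    with hit_less_hit_iff[of \<omega> V B A] disjoint show ?thesis by blast
  qed
  then have "\<P>(\<omega> in ?P. \<exists>k. ?E k \<omega>) = q x"
    unfolding committor_def by (intro arg_cong[where f = "measure ?P"]) auto
  ultimately show ?thesis by simp
qed

lemma committor_nonneg: "x \<in> V \<Longrightarrow> 0 \<le> q x"
  by (rule sums_le[OF _ sums_zero committor_sums]) (auto intro: cyl_nonneg[OF stochastic])

lemma cyl_le_committor:
  assumes "x \<in> V"
  shows "cyl V p (replicate k C @ [B]) x \<le> q x"
  using sum_le_suminf[OF sums_summable[OF committor_sums[OF assms]], of "{k}"]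
    sums_unique[OF committor_sums[OF assms]] cyl_nonneg[OF stochastic assms] by simp

lemma committor_B:
  assumes "x \<in> B" shows "q x = 1"
proof -
  have "cyl V p (replicate k C @ [B]) x = (if k = 0 then 1 else 0)" for k
    using assms B_subset p_sum[of x] by (cases k) auto
  then have "(\<lambda>k. cyl V p (replicate k C @ [B]) x) sums 1"
    using sums_single[of 0 "\<lambda>_. 1 :: real"] by simp
  then show ?thesis using committor_sums[of x] assms B_subset sums_unique2 by blast
qed

lemma committor_A:
  assumes "x \<in> A" shows "q x = 0"
proof -
  have "cyl V p (replicate k C @ [B]) x = 0" for k
    using assms disjoint by (cases k) auto
  then show ?thesis using committor_sums[of x] assms A_subset sums_unique2[OF _ sums_zero] by auto
qed

text \<open>First-step analysis on the series: for \<open>x\<close> in \<open>C\<close> the term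
  with \<open>k = 0\<close> vanishes, and each later term is the one-step average of the preceding
  one.\<close>

lemma committor_harmonic:
  assumes "x \<in> C" shows "q x = s x"
proof -
  have "(\<lambda>k. cyl V p (replicate (Suc k) C @ [B]) x) sums s x"
    using assms by (auto intro!: sums_sum sums_mult committor_sums)
  moreover have "cyl V p (replicate 0 C @ [B]) x = 0" using assms by simp
  ultimately have "(\<lambda>k. cyl V p (replicate k C @ [B]) x) sums s x"
    using sums_Suc[of "\<lambda>k. cyl V p (replicate k C @ [B]) x" "s x"] by (simp only: add_0_right)
  then show ?thesis using committor_sums[of x] assms sums_unique2 by blast
qed

lemma committor_step_pos:
  assumes "x \<in> V" "y \<in> V" "p y x > 0" "q y > 0"
  shows "s x > 0"
proof -
  have "0 < p y x * q y" using assms by simp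
  also have "\<dots> \<le> s x"
    using assms finite_V by (intro member_le_sum) (auto intro: mult_nonneg_nonneg p_nonneg committor_nonneg)
  finally show ?thesis .
qed

text \<open>Positivity of \<open>q\<close> spreads backwards along a path to \<open>B\<close>, from
  the value 1 at its end and by harmonicity inside \<open>C\<close>. It stops at \<open>u 1\<close>,
  because \<open>q\<close> is zero on \<open>A\<close>; the last step back yields \<open>s x\<close>
  instead.\<close>

lemma exit_pos:
  assumes "x \<in> A"
  shows "s x > 0"
proof -
  obtain k u where u: "u 0 = x" "u k \<in> B" "\<forall>l. 1 \<le> l \<and> l < k \<longrightarrow> u l \<in> C"
    "\<forall>l<k. p (u (Suc l)) (u l) > 0"
    using reach_B[OF assms] unfolding reachable_def by blast
  have k: "k \<noteq> 0" using u assms disjoint by (intro notI) auto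
  have V: "u l \<in> V" if "l \<le> k" for l
    using u assms A_subset B_subset that by (cases "l = 0"; cases "l = k") auto
  have "q (u l) > 0" if "1 \<le> l" "l \<le> k" for l
    using that(2,1)
  proof (induction rule: inc_induct)
    case base
    then show ?case using u by (simp add: committor_B)
  next
    case (step l)
    then have "s (u l) > 0" using u V by (intro committor_step_pos[of _ "u (Suc l)"]) auto
    then show ?case using step u by (subst committor_harmonic) auto
  qed
  with k have "q (u 1) > 0" by simp
  then show ?thesis using u(1,4) V[of 0] V[of 1] k by (intro committor_step_pos[of _ "u 1"]) auto
qed

text \<open>On \<open>C\<close> the defining sum is \<open>q x\<close> itself; on \<open>A\<close>
  it is positive by \<open>exit_pos\<close>.\<close>

lemma V_plus_iff:
  "x \<in> V_plus V p A B \<longleftrightarrow> x \<in> A \<or> x \<in> C \<and> q x > 0"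
  using exit_pos A_subset disjoint by (auto simp: V_plus_def committor_harmonic)

lemma committor_outside:
  assumes "x \<in> V" "x \<notin> V_plus V p A B \<union> B"
  shows "q x = 0"
  using assms committor_nonneg[of x] by (auto simp: V_plus_iff)

lemma V_plus_Un_B_subset: "V_plus V p A B \<union> B \<subseteq> V"
  using A_subset B_subset by (auto simp: V_plus_iff)

section \<open>The reactive chain: normalisation and path probabilities\<close>

lemma stochastic_reactive_transition:
  "stochastic_on (V_plus V p A B \<union> B) (reactive_transition V p A B)"
  unfolding stochastic_on_def
proof
  let ?S = "V_plus V p A B \<union> B"
  have fin: "finite ?S" using finite_V V_plus_Un_B_subset by (rule rev_finite_subset)
  fix y assume y: "y \<in> ?S"
  show "distribution_on ?S (\<lambda>x. reactive_transition V p A B x y)"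
  proof (cases "y \<in> B")
    case True
    then show ?thesis using fin y
      by (simp add: distribution_on_def reactive_transition_def delta_def)
  next
    case False
    then have pos: "s y > 0" and yV: "y \<in> V" using y by (auto simp: V_plus_def)
    \<comment> \<open>By harmonicity the denominator \<open>q y\<close> on \<open>C\<close> equals
      \<open>s y\<close>, so both branches off \<open>B\<close> share one formula.\<close>
    have eq: "reactive_transition V p A B x y = p x y * q x / s y" for x
      using False y committor_harmonic[of y] by (auto simp: reactive_transition_def V_plus_iff Let_def)
    have "(\<Sum>x\<in>?S. p x y * q x) = s y"
      using finite_V V_plus_Un_B_subset committor_outside by (intro sum.mono_neutral_left) auto
    then have "(\<Sum>x\<in>?S. p x y * q x / s y) = 1"
      using pos by (simp add: sum_divide_distrib[symmetric])
    moreover have "0 \<le> p x y * q x / s y" if "x \<in> ?S" for x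
      using that yV V_plus_Un_B_subset pos
      by (intro divide_nonneg_pos mult_nonneg_nonneg p_nonneg committor_nonneg) auto
    ultimately show ?thesis using fin by (simp add: distribution_on_def eq)
  qed
qed

text \<open>The path is one way of reaching \<open>B\<close> through \<open>C\<close>, so its
  probability is at most \<open>q y\<close>, which is zero here.\<close>

lemma cyl_path_outside:
  assumes "set ys \<subseteq> C" "b \<in> B" "y \<in> V" "y \<notin> V_plus V p A B \<union> B"
  shows "cyl V p (map (\<lambda>y. {y}) (ys @ [b])) y = 0" (is "cyl V p ?Ds y = 0")
proof -
  have "ys ! i \<in> C" if "i < length ys" for i
    using assms(1) that nth_mem by blast
  then have "list_all2 (\<subseteq>) ?Ds (replicate (length ys) C @ [B])"
    using assms(2) by (auto simp: list_all2_conv_all_nth nth_append)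
  then have "cyl V p ?Ds y \<le> cyl V p (replicate (length ys) C @ [B]) y"
    by (intro cyl_mono[OF stochastic assms(3)])
  also have "\<dots> \<le> 0"
    using cyl_le_committor[OF assms(3)] committor_outside[OF assms(3,4)] by metis
  finally show ?thesis using cyl_nonneg[OF stochastic assms(3)] by (meson antisym)
qed

text \<open>The reactive chain is a Doob transform of the original chain: the factors \<open>q\<close> telescope
  along a path.\<close>

lemma cyl_reactive_transition:
  assumes "set ys \<subseteq> C" "b \<in> B" "z \<in> V_plus V p A B \<union> B"
  shows "cyl (V_plus V p A B \<union> B) (reactive_transition V p A B) (map (\<lambda>y. {y}) (ys @ [b])) z * q z =
    cyl V p (map (\<lambda>y. {y}) (ys @ [b])) z"
  using assms(1,3)
proof (induction ys arbitrary: z)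
  case Nil
  show ?case
    using Nil assms(2) B_subset p_sum[of b] stochastic_onD(3)[OF stochastic_reactive_transition Nil(2)]
    by (auto simp: committor_B)
next
  case (Cons c ys)
  let ?S = "V_plus V p A B \<union> B" and ?Ds = "map (\<lambda>y. {y}) (ys @ [b])"
  let ?r = "reactive_transition V p A B"
  show ?case
  proof (cases "z = c")
    case True
    then have c: "c \<in> C" "q c > 0" using Cons.prems by (auto simp: V_plus_iff)
    have zero: "cyl V p ?Ds y = 0" if "y \<in> V" "y \<notin> ?S" for y
      using Cons.prems(1) assms(2) that by (intro cyl_path_outside) auto
    \<comment> \<open>The denominator \<open>q c\<close> cancels, and the factor \<open>q y\<close>
      from the numerator is the one that the induction hypothesis at \<open>y\<close>
      absorbs.\<close>
    have "(\<Sum>y\<in>?S. ?r y c * cyl ?S ?r ?Ds y) * q c = (\<Sum>y\<in>?S. p y c * (cyl ?S ?r ?Ds y * q y))"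
      using c by (auto simp: sum_distrib_right reactive_transition_def Let_def intro!: sum.cong)
    also have "\<dots> = (\<Sum>y\<in>?S. p y c * cyl V p ?Ds y)"
      using Cons by (intro sum.cong refl arg_cong2[where f = "(*)"]) auto
    also have "\<dots> = (\<Sum>y\<in>V. p y c * cyl V p ?Ds y)"
      using zero V_plus_Un_B_subset finite_V by (intro sum.mono_neutral_left) auto
    finally show ?thesis using True by simp
  qed simp
qed

text \<open>The first step out of \<open>A\<close> is normalised by \<open>s a\<close>, as
  \<open>q a\<close> is zero; this denominator does not telescope and stays.\<close>

lemma cyl_reactive_transition_from_A:
  assumes "a \<in> A" "set ys \<subseteq> C" "b \<in> B"
  shows "(\<Sum>z\<in>V_plus V p A B \<union> B. reactive_transition V p A B z a *
      cyl (V_plus V p A B \<union> B) (reactive_transition V p A B) (map (\<lambda>y. {y}) (ys @ [b])) z) =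
    (\<Sum>z\<in>V. p z a * cyl V p (map (\<lambda>y. {y}) (ys @ [b])) z) / s a"
proof -
  let ?S = "V_plus V p A B \<union> B" and ?Ds = "map (\<lambda>y. {y}) (ys @ [b])"
  let ?r = "reactive_transition V p A B"
  have "(\<Sum>z\<in>?S. ?r z a * cyl ?S ?r ?Ds z) = (\<Sum>z\<in>?S. p z a * (cyl ?S ?r ?Ds z * q z)) / s a"
    using assms(1) disjoint
    by (auto simp: sum_divide_distrib reactive_transition_def Let_def intro!: sum.cong)
  also have "(\<Sum>z\<in>?S. p z a * (cyl ?S ?r ?Ds z * q z)) = (\<Sum>z\<in>?S. p z a * cyl V p ?Ds z)"
    by (intro sum.cong refl arg_cong2[where f = "(*)"] cyl_reactive_transition assms(2,3))
  also have "\<dots> = (\<Sum>z\<in>V. p z a * cyl V p ?Ds z)"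
    using V_plus_Un_B_subset finite_V cyl_path_outside[OF assms(2,3)]
    by (intro sum.mono_neutral_left) auto
  finally show ?thesis .
qed

end

section \<open>The law of the reactive trajectory\<close>

text \<open>\<open>average_eq_max\<close> is iterated along the path. Averaging is asked only at
  points where \<open>h\<close> attains \<open>m\<close>, which allows for a function that is not
  harmonic on \<open>B\<close>.\<close>

lemma reachable_max_in_target:
  fixes h :: "'a \<Rightarrow> real"
  assumes "stochastic_on V p" "reachable V p A B T x" "x \<in> V" "T \<subseteq> V"
    and "\<And>y. y \<in> V \<Longrightarrow> h y \<le> m" "h x = m"
    and "\<And>y. y \<in> V \<Longrightarrow> h y = m \<Longrightarrow> (\<Sum>z\<in>V. p z y * h z) = m"
  shows "\<exists>y\<in>T. h y = m"
proof -
  obtain k u where u: "u 0 = x" "u k \<in> T" "\<forall>l. 1 \<le> l \<and> l < k \<longrightarrow> u l \<in> V - (A \<union> B)"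
    "\<forall>l<k. p (u (Suc l)) (u l) > 0"
    using assms(2) unfolding reachable_def by blast
  have V: "u l \<in> V" if "l \<le> k" for l
    using u assms(3,4) that by (cases "l = 0"; cases "l = k") auto
  have "h (u l) = m" if "l \<le> k" for l
    using that
  proof (induction l)
    case 0
    then show ?case using u(1) assms(6) by simp
  next
    case (Suc l)
    then show ?case
      using u(4) V[of l] V[of "Suc l"] assms(7)[of "u l"]
      by (intro average_eq_max[OF assms(1) _ assms(5), of "u l"]) auto
  qed
  then show ?thesis using u(2) by blast
qed

context transition_problem
begin

text \<open>The limit is harmonic off \<open>B\<close> and vanishes on \<open>B\<close>, so by the maximum principle its
  maximum propagates along a path to \<open>B\<close>.\<close>

lemma avoid_B_tendsto_0:
  assumes "x \<in> V"
  shows "(\<lambda>k. cyl V p (replicate k (- B)) x) \<longlonglongrightarrow> 0"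
proof -
  let ?h = "\<lambda>k x. cyl V p (replicate k (- B)) x"
  have "\<exists>L. (\<lambda>k. ?h k x) \<longlonglongrightarrow> L" if "x \<in> V" for x
  proof -
    have "decseq (\<lambda>k. ?h k x)"
      using cyl_replicate_antimono[OF stochastic that] by (intro decseq_SucI)
    then show ?thesis
      using decseq_convergent[of "\<lambda>k. ?h k x" 0] cyl_nonneg[OF stochastic that] by metis
  qed
  then obtain h where h: "\<And>x. x \<in> V \<Longrightarrow> (\<lambda>k. ?h k x) \<longlonglongrightarrow> h x" by metis
  have nonneg: "0 \<le> h x" if "x \<in> V" for x
    using h[OF that] cyl_nonneg[OF stochastic that] by (intro LIMSEQ_le_const) auto
  have rec: "h x = of_bool (x \<notin> B) * (\<Sum>y\<in>V. p y x * h y)" if "x \<in> V" for x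
  proof -
    have "(\<lambda>k. ?h (Suc k) x) \<longlonglongrightarrow> of_bool (x \<notin> B) * (\<Sum>y\<in>V. p y x * h y)"
      by (auto intro!: tendsto_intros h)
    with LIMSEQ_Suc[OF h[OF that]] show ?thesis by (rule LIMSEQ_unique)
  qed
  define m where "m = Max (h ` V)"
  have le: "h y \<le> m" if "y \<in> V" for y using that finite_V by (simp add: m_def)
  have "m \<le> 0"
  proof (rule ccontr)
    assume "\<not> m \<le> 0"
    then have m: "m > 0" by simp
    \<comment> \<open>On \<open>B\<close> the recursion gives the value 0, below \<open>m\<close>,
      so a maximum point lies off \<open>B\<close>, where the recursion is averaging.\<close>
    have avg: "(\<Sum>z\<in>V. p z y * h z) = m" if "y \<in> V" "h y = m" for y
      using rec[OF that(1)] that(2) m by (cases "y \<in> B") auto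
    have B: "h b \<noteq> m" if "b \<in> B" for b
      using rec[of b] that B_subset m by auto
    \<comment> \<open>\<open>A\<close> comes before \<open>C\<close>, because a path from
      \<open>C\<close> may end in \<open>A\<close>.\<close>
    have A: "h a \<noteq> m" if "a \<in> A" for a
      using reachable_max_in_target[OF stochastic reach_B[OF that] _ B_subset le _ avg] that A_subset B
      by blast
    have "m \<in> h ` V" unfolding m_def using finite_V assms by (intro Max_in) auto
    then obtain x where x: "x \<in> V" "h x = m" by blast
    then have "x \<in> C" using A B by auto
    with reach_AB[OF this] show False
      using reachable_max_in_target[OF stochastic _ x(1) A_subset le x(2) avg]
        reachable_max_in_target[OF stochastic _ x(1) B_subset le x(2) avg] A B by blast
  qed
  then have "h x = 0" using nonneg[OF assms] le[OF assms] by simp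
  then show ?thesis using h[OF assms] by simp
qed

end

section \<open>Decomposition of the first passage path at its last visit to \<open>A\<close>\<close>

locale first_passage = transition_problem V A B p
  for V A B :: "'a :: countable set" and p :: "'a \<Rightarrow> 'a \<Rightarrow> real" +
  fixes \<mu> :: "'a \<Rightarrow> real" and M :: "'w measure" and X :: "nat \<Rightarrow> 'w \<Rightarrow> 'a"
  assumes \<mu>: "distribution_on A \<mu>" and chain: "markov_chain M X V p"
    and initial: "initial_distribution M X A \<mu>"
begin

sublocale prob_space M
  using chain by (simp add: markov_chain_def)

declare markov_chain_pred[OF chain, measurable]

lemma pred_eq [measurable]: "Measurable.pred M (\<lambda>\<omega>. X i \<omega> = x)"
  using markov_chain_pred[OF chain, of i "{x}"] by simp

lemma in_V: "\<omega> \<in> space M \<Longrightarrow> X i \<omega> \<in> V"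
  using chain measurable_space[of "X i" M "count_space V"] by (simp add: markov_chain_def)

lemma measurable_last_hit_chain [measurable]:
  "(\<lambda>\<omega>. last_hit A B (\<lambda>k. X k \<omega>)) \<in> M \<rightarrow>\<^sub>M count_space UNIV"
  by (rule measurable_last_hit) measurable

lemma pred_last_hit [measurable]:
  "Measurable.pred M (\<lambda>\<omega>. X (last_hit A B (\<lambda>k. X k \<omega>)) \<omega> = x)"
  by (rule measurable_compose_countable[where f = "\<lambda>l \<omega>. X l \<omega> = x"]) measurable

lemma measurable_reactive_trajectory [measurable]:
  "(\<lambda>\<omega>. reactive_trajectory A B (\<lambda>k. X k \<omega>)) \<in> M \<rightarrow>\<^sub>M count_space UNIV"
  unfolding reactive_trajectory_def
  by (intro measurable_path_segment measurable_hit measurable_last_hit_chain) measurable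

lemma AE_starts_in_A: "AE \<omega> in M. X 0 \<omega> \<in> A"
proof -
  have "\<P>(\<omega> in M. X 0 \<omega> \<in> A) = (\<Sum>x\<in>A. \<P>(\<omega> in M. X 0 \<omega> = x))"
    using \<mu> by (intro prob_sum) (auto simp: distribution_on_def)
  also have "\<dots> = 1"
    using \<mu> initial by (simp add: distribution_on_def initial_distribution_def)
  finally show ?thesis by (subst (asm) prob_Collect_eq_1) simp_all
qed

text \<open>Avoiding \<open>B\<close> forever is, for every \<open>k\<close>, at most as likely as
  avoiding it for \<open>k\<close> steps, and that bound is a finite mixture of terms tending to
  zero.\<close>

lemma AE_hits_B: "AE \<omega> in M. hit B (\<lambda>k. X k \<omega>) < \<infinity>"
proof -
  have "\<P>(\<omega> in M. \<forall>k. X k \<omega> \<notin> B) \<le>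
      (\<Sum>x\<in>V. \<P>(\<omega> in M. X 0 \<omega> = x) * cyl V p (replicate k (- B)) x)" for k
  proof -
    have "\<P>(\<omega> in M. \<forall>k. X k \<omega> \<notin> B) \<le>
        \<P>(\<omega> in M. \<forall>j<length (replicate k (- B)). X j \<omega> \<in> replicate k (- B) ! j)"
      by (intro finite_measure_mono) auto
    then show ?thesis by (simp only: markov_chain_cyl[OF chain stochastic finite_V])
  qed
  moreover have "(\<lambda>k. \<Sum>x\<in>V. \<P>(\<omega> in M. X 0 \<omega> = x) * cyl V p (replicate k (- B)) x)
      \<longlonglongrightarrow> (\<Sum>x\<in>V. \<P>(\<omega> in M. X 0 \<omega> = x) * 0)"
    by (intro tendsto_sum tendsto_mult tendsto_const avoid_B_tendsto_0)
  ultimately have "\<P>(\<omega> in M. \<forall>k. X k \<omega> \<notin> B) \<le> 0"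
    by (intro LIMSEQ_le_const) auto
  then have "\<P>(\<omega> in M. \<forall>k. X k \<omega> \<notin> B) = 0" by (simp add: measure_le_0_iff)
  then have "AE \<omega> in M. \<not> (\<forall>k. X k \<omega> \<notin> B)" by (subst (asm) prob_Collect_eq_0) simp_all
  then show ?thesis unfolding hit_finite_iff by simp
qed

text \<open>For \<open>x\<close> in \<open>A\<close>, the sum over \<open>l\<close> is the Green
  function of the chain killed on \<open>B\<close>.\<close>

definition visit :: "nat \<Rightarrow> 'a \<Rightarrow> real" where
  "visit l x = \<P>(\<omega> in M. (\<forall>i<l. X i \<omega> \<notin> B) \<and> X l \<omega> = x)"

text \<open>The visit is a cylinder event whose last set is the singleton \<open>{x}\<close>, so
  \<open>cyl_append_singleton\<close> splits off the future.\<close>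

lemma prob_visit_then:
  assumes "x \<in> V"
  shows "\<P>(\<omega> in M. ((\<forall>i<l. X i \<omega> \<notin> B) \<and> X l \<omega> = x) \<and>
      (\<forall>j<length Ds. X (Suc l + j) \<omega> \<in> Ds ! j)) =
    visit l x * (\<Sum>z\<in>V. p z x * cyl V p Ds z)"
proof -
  let ?R = "replicate l (- B)"
  have "((\<forall>i<l. X i \<omega> \<notin> B) \<and> X l \<omega> = x) \<and> (\<forall>j<length Ds. X (Suc l + j) \<omega> \<in> Ds ! j) \<longleftrightarrow>
      (\<forall>j<length ((?R @ [{x}]) @ Ds). X j \<omega> \<in> ((?R @ [{x}]) @ Ds) ! j)" for \<omega>
    unfolding in_nth_append_iff by (simp cong: conj_cong)
  moreover have "(\<forall>i<l. X i \<omega> \<notin> B) \<and> X l \<omega> = x \<longleftrightarrow>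
      (\<forall>j<length (?R @ [{x}]). X j \<omega> \<in> (?R @ [{x}]) ! j)" for \<omega>
    unfolding in_nth_append_iff by (simp cong: conj_cong)
  ultimately show ?thesis
    by (simp only: visit_def markov_chain_cyl[OF chain stochastic finite_V] append_assoc append.simps
        cyl_append_singleton[OF stochastic assms, of ?R Ds] sum_distrib_right mult.assoc)
qed

text \<open>Sum over the time \<open>l\<close> of the last visit. Given the visit, the future must
  reach \<open>B\<close> before \<open>A\<close> after one jump, which has weight
  \<open>s x\<close>.\<close>

lemma reactive_initial_sums:
  assumes "x \<in> A"
  shows "(\<lambda>l. visit l x * s x) sums reactive_initial M X A B x"
proof -
  have V: "x \<in> V" using assms A_subset by blast
  let ?K = "\<lambda>l k \<omega>. (\<forall>i<k. X (Suc l + i) \<omega> \<in> C) \<and> X (Suc l + k) \<omega> \<in> B"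
  let ?E = "\<lambda>l \<omega>. ((\<forall>i<l. X i \<omega> \<notin> B) \<and> X l \<omega> = x) \<and> (\<exists>k. ?K l k \<omega>)"
  have E: "\<P>(\<omega> in M. ?E l \<omega>) = visit l x * s x" for l
  proof -
    have "(\<lambda>k. \<P>(\<omega> in M. ((\<forall>i<l. X i \<omega> \<notin> B) \<and> X l \<omega> = x) \<and> ?K l k \<omega>)) sums \<P>(\<omega> in M. ?E l \<omega>)"
    proof (rule prob_sums)
      have "i = k" if "?K l i \<omega>" "?K l k \<omega>" for i k :: nat and \<omega>
        using that by (cases i k rule: linorder_cases) auto
      then show "AE \<omega> in M. (\<forall>k. ((\<forall>i<l. X i \<omega> \<notin> B) \<and> X l \<omega> = x) \<and> ?K l k \<omega> \<longrightarrow> ?E l \<omega>) \<and>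
          (?E l \<omega> \<longrightarrow> (\<exists>!k. ((\<forall>i<l. X i \<omega> \<notin> B) \<and> X l \<omega> = x) \<and> ?K l k \<omega>))"
        by (intro AE_I2) blast
    qed measurable
    moreover have "\<P>(\<omega> in M. ((\<forall>i<l. X i \<omega> \<notin> B) \<and> X l \<omega> = x) \<and> ?K l k \<omega>) =
        visit l x * (\<Sum>z\<in>V. p z x * cyl V p (replicate k C @ [B]) z)" for k
    proof -
      have "?K l k \<omega> \<longleftrightarrow> (\<forall>j<length (replicate k C @ [B]). X (Suc l + j) \<omega> \<in> (replicate k C @ [B]) ! j)"
        for \<omega>
        unfolding in_nth_append_iff by (simp cong: conj_cong)
      then show ?thesis by (simp only: prob_visit_then[OF V])
    qed
    ultimately have "(\<lambda>k. visit l x * (\<Sum>z\<in>V. p z x * cyl V p (replicate k C @ [B]) z)) sums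
        \<P>(\<omega> in M. ?E l \<omega>)" by simp
    \<comment> \<open>This is the committor series, averaged over the state \<open>z\<close> after
      the jump.\<close>
    moreover have "(\<lambda>k. visit l x * (\<Sum>z\<in>V. p z x * cyl V p (replicate k C @ [B]) z)) sums
        (visit l x * s x)"
      by (intro sums_mult sums_sum committor_sums)
    ultimately show ?thesis by (rule sums_unique2)
  qed
  have "(\<lambda>l. \<P>(\<omega> in M. ?E l \<omega>)) sums reactive_initial M X A B x"
    unfolding reactive_initial_def
  proof (rule prob_sums)
    show "AE \<omega> in M. (\<forall>l. ?E l \<omega> \<longrightarrow> X (last_hit A B (\<lambda>k. X k \<omega>)) \<omega> = x) \<and>
        (X (last_hit A B (\<lambda>k. X k \<omega>)) \<omega> = x \<longrightarrow> (\<exists>!l. ?E l \<omega>))"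
      using AE_starts_in_A AE_hits_B AE_space
    proof eventually_elim
      case (elim \<omega>)
      \<comment> \<open>Almost surely only the last hitting time can serve as \<open>l\<close>,
        which gives the uniqueness that \<open>prob_sums\<close> asks for.\<close>
      have "?E l \<omega> \<longleftrightarrow> X (last_hit A B (\<lambda>k. X k \<omega>)) \<omega> = x \<and> l = last_hit A B (\<lambda>k. X k \<omega>)" for l
        using first_passage_iff[of "\<lambda>k. X k \<omega>" V A B x l] elim in_V assms disjoint by blast
      then show ?case by (simp only:) simp
    qed
  qed measurable
  with E show ?thesis by simp
qed

text \<open>The sum over \<open>l\<close> need not be computed: after multiplying and dividing by
  \<open>s a\<close>, which is positive by \<open>exit_pos\<close>, it is the series of
  \<open>reactive_initial_sums\<close>.\<close>

lemma prob_reactive_trajectory: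
  assumes "a \<in> A" "set ys \<subseteq> C" "b \<in> B"
  shows "\<P>(\<omega> in M. reactive_trajectory A B (\<lambda>k. X k \<omega>) = a # ys @ [b]) =
    reactive_initial M X A B a * ((\<Sum>z\<in>V. p z a * cyl V p (map (\<lambda>y. {y}) (ys @ [b])) z) / s a)"
proof -
  let ?xs = "a # ys @ [b]" and ?Ds = "map (\<lambda>y. {y}) (ys @ [b])"
  let ?E = "\<lambda>l \<omega>. (\<forall>i<l. X i \<omega> \<notin> B) \<and> (\<forall>i<length ?xs. X (l + i) \<omega> = ?xs ! i)"
  let ?w = "\<Sum>z\<in>V. p z a * cyl V p ?Ds z"
  have xs: "?xs \<in> transition_lists V A B" using assms unfolding transition_lists_def by blast
  have "(\<lambda>l. \<P>(\<omega> in M. ?E l \<omega>)) sums \<P>(\<omega> in M. reactive_trajectory A B (\<lambda>k. X k \<omega>) = ?xs)"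
  proof (rule prob_sums)
    show "AE \<omega> in M. (\<forall>l. ?E l \<omega> \<longrightarrow> reactive_trajectory A B (\<lambda>k. X k \<omega>) = ?xs) \<and>
        (reactive_trajectory A B (\<lambda>k. X k \<omega>) = ?xs \<longrightarrow> (\<exists>!l. ?E l \<omega>))"
      using AE_starts_in_A AE_hits_B AE_space
    proof eventually_elim
      case (elim \<omega>)
      have "?E l \<omega> \<longleftrightarrow> reactive_trajectory A B (\<lambda>k. X k \<omega>) = ?xs \<and> l = last_hit A B (\<lambda>k. X k \<omega>)" for l
        by (rule reactive_trajectory_eq_iff[OF _ disjoint _ _ xs, symmetric]) (use elim in_V in auto)
      then show ?case by (simp only:) simp
    qed
  qed measurable
  moreover have "\<P>(\<omega> in M. ?E l \<omega>) = visit l a * s a * (?w / s a)" for l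
  proof -
    have "?E l \<omega> \<longleftrightarrow> ((\<forall>i<l. X i \<omega> \<notin> B) \<and> X l \<omega> = a) \<and>
        (\<forall>j<length ?Ds. X (Suc l + j) \<omega> \<in> ?Ds ! j)" for \<omega>
    proof -
      have "?Ds ! j = {(ys @ [b]) ! j}" if "j < Suc (length ys)" for j
        using that nth_map[of j "ys @ [b]" "\<lambda>y. {y}"] by simp
      then show ?thesis by (auto simp: All_less_Suc2 simp del: map_append)
    qed
    then have "\<P>(\<omega> in M. ?E l \<omega>) = visit l a * ?w"
      using assms(1) A_subset by (simp only: prob_visit_then subsetD)
    then show ?thesis using exit_pos[OF assms(1)] by simp
  qed
  moreover have "(\<lambda>l. visit l a * s a * (?w / s a)) sums (reactive_initial M X A B a * (?w / s a))"
    by (intro sums_mult2 reactive_initial_sums assms(1))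
  ultimately show ?thesis using sums_unique2 by simp
qed

lemma distribution_on_reactive_initial: "distribution_on A (reactive_initial M X A B)"
proof -
  have "(\<Sum>x\<in>A. reactive_initial M X A B x) = \<P>(\<omega> in M. True)"
    unfolding reactive_initial_def
  proof (rule prob_sum[symmetric])
    show "finite A" using A_subset finite_V by (rule finite_subset)
    \<comment> \<open>A path that starts in \<open>A\<close> and hits \<open>B\<close> has its last
      hitting point in \<open>A\<close>, so exactly one \<open>x\<close> qualifies.\<close>
    show "AE \<omega> in M. (\<forall>x\<in>A. X (last_hit A B (\<lambda>k. X k \<omega>)) \<omega> = x \<longrightarrow> True) \<and>
        (True \<longrightarrow> (\<exists>!x\<in>A. X (last_hit A B (\<lambda>k. X k \<omega>)) \<omega> = x))"
      using AE_starts_in_A AE_hits_B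
    proof eventually_elim
      case (elim \<omega>)
      obtain h where "hit B (\<lambda>k. X k \<omega>) = enat h" using elim(2) by (cases "hit B (\<lambda>k. X k \<omega>)") auto
      from last_hit_in(1)[OF elim(1) disjoint this] show ?case by blast
    qed
  qed (use pred_last_hit in auto)
  then show ?thesis
    using A_subset finite_V prob_space
    by (auto simp: distribution_on_def reactive_initial_def intro: finite_subset)
qed

text \<open>The point masses agree on every transition list, and the reactive trajectory of
  \<open>X\<close> is almost surely such a list; \<open>measure_eqI_countable_full\<close> then
  settles both claims.\<close>

lemma reactive_chain:
  fixes N :: "'v measure" and Y :: "nat \<Rightarrow> 'v \<Rightarrow> 'a"
  assumes "markov_chain N Y (V_plus V p A B \<union> B) (reactive_transition V p A B)"
    and "initial_distribution N Y A (reactive_initial M X A B)"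
  shows "AE \<omega> in N. hit B (\<lambda>k. Y k \<omega>) < \<infinity>"
    and "distr M (count_space UNIV) (\<lambda>\<omega>. reactive_trajectory A B (\<lambda>k. X k \<omega>)) =
      distr N (count_space UNIV) (\<lambda>\<omega>. stopped_path B (\<lambda>k. Y k \<omega>))"
proof -
  let ?S = "V_plus V p A B \<union> B" and ?r = "reactive_transition V p A B"
  let ?T = "transition_lists V A B"
  let ?RX = "\<lambda>\<omega>. reactive_trajectory A B (\<lambda>k. X k \<omega>)" and ?SY = "\<lambda>\<omega>. stopped_path B (\<lambda>k. Y k \<omega>)"
  interpret N: prob_space N using assms(1) by (simp add: markov_chain_def)
  have fin: "finite ?S" using V_plus_Un_B_subset finite_V by (rule finite_subset)
  have [measurable]: "?RX \<in> M \<rightarrow>\<^sub>M count_space UNIV" by (rule measurable_reactive_trajectory)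
  have [measurable]: "?SY \<in> N \<rightarrow>\<^sub>M count_space UNIV"
    unfolding stopped_path_def
    using markov_chain_pred[OF assms(1), of _ "{_}"] markov_chain_pred[OF assms(1)]
    by (intro measurable_path_segment measurable_hit) simp_all
  have eq: "emeasure (distr M (count_space UNIV) ?RX) {xs} = emeasure (distr N (count_space UNIV) ?SY) {xs}"
    if xs: "xs \<in> ?T" for xs
  proof -
    obtain a ys b where ab: "xs = a # ys @ [b]" "a \<in> A" "set ys \<subseteq> C" "b \<in> B"
      using xs unfolding transition_lists_def by blast
    let ?Ds = "map (\<lambda>y. {y}) (ys @ [b])"
    have a: "a \<in> ?S" using ab(2) by (simp add: V_plus_iff)
    have "\<P>(\<omega> in N. ?SY \<omega> = xs) =
        \<P>(\<omega> in N. \<forall>j<length (map (\<lambda>y. {y}) xs). Y j \<omega> \<in> map (\<lambda>y. {y}) xs ! j)"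
      unfolding stopped_path_eq_iff[OF disjoint xs] by simp
    \<comment> \<open>The first entry of the list is \<open>{a}\<close>, so only the start at
      \<open>a\<close> contributes.\<close>
    also have "\<dots> = (\<Sum>y\<in>?S. if y = a then \<P>(\<omega> in N. Y 0 \<omega> = a) * (\<Sum>z\<in>?S. ?r z a * cyl ?S ?r ?Ds z) else 0)"
      unfolding markov_chain_cyl[OF assms(1) stochastic_reactive_transition fin]
      by (intro sum.cong refl) (simp add: ab(1))
    also have "\<dots> = reactive_initial M X A B a * ((\<Sum>z\<in>V. p z a * cyl V p ?Ds z) / s a)"
      using assms(2) ab(2) a fin
      by (simp add: initial_distribution_def cyl_reactive_transition_from_A[OF ab(2-4)] del: map_append)
    also have "\<dots> = \<P>(\<omega> in M. ?RX \<omega> = xs)"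
      unfolding ab(1) by (rule prob_reactive_trajectory[OF ab(2-4), symmetric])
    finally show ?thesis
      by (simp add: emeasure_distr vimage_def Int_def conj_commute emeasure_eq_measure N.emeasure_eq_measure)
  qed
  have AE: "AE xs in distr M (count_space UNIV) ?RX. xs \<in> ?T"
  proof (subst AE_distr_iff)
    show "AE \<omega> in M. ?RX \<omega> \<in> ?T"
      using AE_starts_in_A AE_hits_B AE_space
      by eventually_elim (rule reactive_trajectory_in_transition_lists, use in_V disjoint in auto)
  qed simp_all
  note * = measure_eqI_countable_full[OF prob_space_distr N.prob_space_distr _ _ eq AE]
  show "distr M (count_space UNIV) ?RX = distr N (count_space UNIV) ?SY"
    by (rule *(1)) simp_all
  have "AE xs in distr N (count_space UNIV) ?SY. xs \<in> ?T" by (rule *(2)) simp_all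
  then have "AE \<omega> in N. ?SY \<omega> \<in> ?T" by (subst (asm) AE_distr_iff) simp_all
  \<comment> \<open>The dummy list \<open>[]\<close> is not a transition list, so membership in
    \<open>?T\<close> forces a finite hitting time.\<close>
  then show "AE \<omega> in N. hit B (\<lambda>k. Y k \<omega>) < \<infinity>"
    by eventually_elim (auto simp: stopped_path_def transition_lists_def split: if_splits)
qed

end

text \<open>The first three conjuncts show that the trajectory and the data of the reactive chain
  are well defined. \<open>N\<close> and \<open>Y\<close> range over all realisations of that chain,
  and finite hitting on both sides means that the dummy list \<open>[]\<close> carries no
  mass.\<close>

theorem proposition5:
  fixes n :: nat and V A B :: "nat set"
    and p :: "nat \<Rightarrow> nat \<Rightarrow> real" and \<mu> :: "nat \<Rightarrow> real"
    and M :: "'w measure" and X :: "nat \<Rightarrow> 'w \<Rightarrow> nat"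
  assumes "n > 1" and "V = {1..n}"
    and "stochastic_on V p"
    and "A \<subseteq> V" and "B \<subseteq> V" and "A \<inter> B = {}" and "A \<noteq> {}" and "B \<noteq> {}"
    and "V - (A \<union> B) \<noteq> {}"
    and "\<forall>x\<in>V - (A \<union> B). reachable V p A B A x \<or> reachable V p A B B x"
    and "\<forall>x\<in>A. reachable V p A B B x"
    and "distribution_on A \<mu>"
    and "markov_chain M X V p" and "initial_distribution M X A \<mu>"
  shows "(AE \<omega> in M. hit B (\<lambda>k. X k \<omega>) < \<infinity>) \<and>
    distribution_on A (reactive_initial M X A B) \<and>
    stochastic_on (V_plus V p A B \<union> B) (reactive_transition V p A B) \<and>
    (\<forall>(N :: 'v measure) (Y :: nat \<Rightarrow> 'v \<Rightarrow> nat).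
       markov_chain N Y (V_plus V p A B \<union> B) (reactive_transition V p A B) \<and>
       initial_distribution N Y A (reactive_initial M X A B) \<longrightarrow>
       (AE \<omega> in N. hit B (\<lambda>k. Y k \<omega>) < \<infinity>) \<and>
       distr M (count_space UNIV) (\<lambda>\<omega>. reactive_trajectory A B (\<lambda>k. X k \<omega>)) =
       distr N (count_space UNIV) (\<lambda>\<omega>. stopped_path B (\<lambda>k. Y k \<omega>)))"
proof -
  interpret transition_problem V A B p
    by unfold_locales (use assms in auto)
  interpret first_passage V A B p \<mu> M X
    by unfold_locales (use assms in auto)
  show ?thesis
    using AE_hits_B distribution_on_reactive_initial stochastic_reactive_transition reactive_chain
    by blast
qed

end
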